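(* Let $d\ge2$, $\delta\in(0,1)$, $\widetilde T\in\mathbb{N}$ and $T=2(d-1)\widetilde T$. Let $$\lambda_0\ge\max\Big\{2,\ \sqrt{\tfrac{2}{3(d-1)}}\tfrac{2d}{12\sqrt{d-1}}+\tfrac{2}{3(d-1)}\Big\}.$$ Consider the stochastic linear bandit with linear vanishing noise (see context) with unknown $\theta\in\mathbb{S}^d$, and run the algorithm LinUCB-VN (see context) for $\widetilde T$ batches with parameters $\lambda_0$ and confidence parameter $\delta_0=\delta/\widetilde T$. Then with probability at least $1-\delta$, $$\mathrm{Regret}(T)\le4(d-1)+\Big(144d^2\beta_{T,\max}^2+24(d-1)^{3/2}\beta_{T,\max}\Big)\log\Big(\frac{T}{2(d-1)}\Big),$$ where $$\beta_{T,\max}=\Big(\lambda_0+\sqrt{2\log\tfrac{T}{\delta}+d\log\big(\tfrac{1}{144\lambda_0}T^2+\tfrac{1}{6\sqrt{\lambda_0}}T+1\big)}\Big)^2 .$$ In particular $\mathrm{Regret}(T)=O(d^4\log^3T)$ with probability at least $1-\delta$ for fixed $\delta$.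
   Context: Model: action set $\mathcal{A}=\mathbb{S}^d=\{x\in\mathbb{R}^d:\|x\|_2=1\}$, unknown $\theta\in\mathbb{S}^d$. When action $a_t$ is played, the reward is $r_t=\langle\theta,a_t\rangle+\epsilon_t$ where, given $\mathcal{F}_{t-1}=\sigma(a_1,r_1,\dots,a_{t-1},r_{t-1},a_t)$, $\epsilon_t$ is conditionally $\sigma_t$-subgaussian ($\mathbb{E}[\epsilon_t\mid\mathcal{F}_{t-1}]=0$, $\mathbb{E}[e^{\mu\epsilon_t}\mid\mathcal{F}_{t-1}]\le e^{\mu^2\sigma_t^2/2}$ for all $\mu$) with $\sigma_t^2\le1-\langle\theta,a_t\rangle^2$. Regret over $T$ rounds: $\mathrm{Regret}(T)=\sum_{t=1}^T(1-\langle\theta,a_t\rangle)$, summing over all individual actions played. Algorithm LinUCB-VN with parameters $\lambda_0$, $\delta_0$: set $V_0=\lambda_0I$ and an arbitrary $\theta^{\mathrm w}_0\in\mathbb{S}^d$. For $t\ge0$ let $\beta_t=\big(\sqrt{2\log(1/\delta_0)+\log(\det V_t/\det V_0)}+\sqrt{\lambda_0}\big)^2$ and $\omega(V_t)=\frac{\sqrt{\lambda_{\max}(V_t)}}{12\sqrt{d-1}\,\beta_t}$. In batch $t=1,2,\dots$: let $\lambda_{t-1,1}\le\dots\le\lambda_{t-1,d}$ be the eigenvalues of $V_{t-1}$ with orthonormal eigenvectors $v_{t-1,i}$; for each $i\in[d-1]$ play the two actions $a^\pm_{t,i}=\tilde a^\pm_{t,i}/\|\tilde a^\pm_{t,i}\|_2$,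 $\tilde a^\pm_{t,i}=\theta^{\mathrm w}_{t-1}\pm\lambda_{t-1,1}^{-1/2}v_{t-1,i}$, receiving rewards $r^\pm_{t,i}$ (so each batch consists of $2(d-1)$ rounds). Set the weight $w_t=1$ if $t=1$ and $w_t=\omega(V_{t-1})$ if $t\ge2$ (the noise estimate for batch $t$ is $\hat\sigma_t^2=1/w_t$). Update $V_t=V_{t-1}+w_t\sum_{i=1}^{d-1}\big(a^+_{t,i}(a^+_{t,i})^{\mathsf T}+a^-_{t,i}(a^-_{t,i})^{\mathsf T}\big)$, $\widetilde\theta^{\mathrm w}_t=V_t^{-1}\sum_{s=1}^t w_s\sum_{i=1}^{d-1}(a^+_{s,i}r^+_{s,i}+a^-_{s,i}r^-_{s,i})$, and $\theta^{\mathrm w}_t=\widetilde\theta^{\mathrm w}_t/\|\widetilde\theta^{\mathrm w}_t\|_2$. *)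

theory Defs
  imports "HOL-Analysis.Analysis" "HOL-Probability.Probability"
begin

definition outer :: "real^'n \<Rightarrow> real^'n \<Rightarrow> real^'n^'n" where
  "outer a b = (\<chi> i j. a$i * b$j)"

definition eigvals :: "real^'n^'n \<Rightarrow> real set" where
  "eigvals V = {l. \<exists>v. v \<noteq> 0 \<and> V *v v = l *\<^sub>R v}"

definition lam_max :: "real^'n^'n \<Rightarrow> real" where
  "lam_max V = Max (eigvals V)"

(* E V i (i = 1..d): an orthonormal basis of eigenvectors of the symmetric matrix V,
   ordered by nondecreasing eigenvalue.  The algorithm may use any such choice. *)
definition eig_selector :: "(real^'n^'n \<Rightarrow> nat \<Rightarrow> real^'n) \<Rightarrow> bool" where
  "eig_selector E \<longleftrightarrow> (\<forall>V::real^'n^'n. transpose V = V \<longrightarrow>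
     (\<forall>i\<in>{1..CARD('n)}. \<forall>j\<in>{1..CARD('n)}. E V i \<bullet> E V j = (if i = j then 1 else 0)) \<and>
     (\<forall>i\<in>{1..CARD('n)}. V *v E V i = (E V i \<bullet> (V *v E V i)) *\<^sub>R E V i) \<and>
     (\<forall>i\<in>{1..CARD('n)}. \<forall>j\<in>{1..CARD('n)}. i \<le> j \<longrightarrow>
         E V i \<bullet> (V *v E V i) \<le> E V j \<bullet> (V *v E V j)))"

definition eigval :: "(real^'n^'n \<Rightarrow> nat \<Rightarrow> real^'n) \<Rightarrow> real^'n^'n \<Rightarrow> nat \<Rightarrow> real" where
  "eigval E V i = E V i \<bullet> (V *v E V i)"

(* beta_t as a function of V_t (V_0 = lam0 I) *)
definition beta_conf :: "real \<Rightarrow> real \<Rightarrow> real^'n^'n \<Rightarrow> real" where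
  "beta_conf lam0 del0 V =
     (sqrt (2 * ln (1 / del0) + ln (det V / det (mat lam0 :: real^'n^'n))) + sqrt lam0)\<^sup>2"

definition omega_w :: "real \<Rightarrow> real \<Rightarrow> real^'n^'n \<Rightarrow> real" where
  "omega_w lam0 del0 V =
     sqrt (lam_max V) / (12 * sqrt (real CARD('n) - 1) * beta_conf lam0 del0 V)"

definition batch_act :: "(real^'n^'n \<Rightarrow> nat \<Rightarrow> real^'n) \<Rightarrow> real^'n^'n \<Rightarrow> real^'n \<Rightarrow> nat \<Rightarrow> real \<Rightarrow> real^'n" where
  "batch_act E V thw i pm =
     (let ta = thw + (pm / sqrt (eigval E V 1)) *\<^sub>R E V i in (1 / norm ta) *\<^sub>R ta)"

(* 0-based round index of the action a^{pm}_{t,i}  (t >= 1, i in 1..d-1, s = 0 for +, 1 for -) *)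
definition round_idx :: "nat \<Rightarrow> nat \<Rightarrow> nat \<Rightarrow> nat \<Rightarrow> nat" where
  "round_idx d t i s = 2 * (d - 1) * (t - 1) + 2 * (i - 1) + s"

(* state (V_t, sum_{s<=t} w_s sum_i (a^+ r^+ + a^- r^-), theta^w_t) after t batches,
   given the reward sequence r indexed by 0-based round *)
fun linucb_state :: "real \<Rightarrow> real \<Rightarrow> (real^'n^'n \<Rightarrow> nat \<Rightarrow> real^'n) \<Rightarrow> real^'n
      \<Rightarrow> (nat \<Rightarrow> real) \<Rightarrow> nat \<Rightarrow> (real^'n^'n) \<times> (real^'n) \<times> (real^'n)" where
  "linucb_state lam0 del0 E th0 r 0 = (mat lam0, 0, th0)"
| "linucb_state lam0 del0 E th0 r (Suc t) =
     (case linucb_state lam0 del0 E th0 r t of (V, b, thw) \<Rightarrow>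
       (let d = CARD('n);
            w = (if t = 0 then 1 else omega_w lam0 del0 V);
            ap = (\<lambda>i. batch_act E V thw i 1);
            am = (\<lambda>i. batch_act E V thw i (-1));
            V' = V + w *\<^sub>R (\<Sum>i\<in>{1..d-1}. outer (ap i) (ap i) + outer (am i) (am i));
            b' = b + w *\<^sub>R (\<Sum>i\<in>{1..d-1}.
                    r (round_idx d (Suc t) i 0) *\<^sub>R ap i + r (round_idx d (Suc t) i 1) *\<^sub>R am i);
            tt = matrix_inv V' *v b'
        in (V', b', (1 / norm tt) *\<^sub>R tt)))"

definition linucb_action :: "real \<Rightarrow> real \<Rightarrow> (real^'n^'n \<Rightarrow> nat \<Rightarrow> real^'n) \<Rightarrow> real^'n
      \<Rightarrow> (nat \<Rightarrow> real) \<Rightarrow> nat \<Rightarrow> real^'n" where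
  "linucb_action lam0 del0 E th0 r k =
     (let d = CARD('n); t = k div (2 * (d - 1)); p = k mod (2 * (d - 1)) in
      case linucb_state lam0 del0 E th0 r t of (V, b, thw) \<Rightarrow>
        batch_act E V thw (p div 2 + 1) (if p mod 2 = 0 then 1 else -1))"

definition hist_alg :: "'a measure \<Rightarrow> (nat \<Rightarrow> 'a \<Rightarrow> real^'n) \<Rightarrow> (nat \<Rightarrow> 'a \<Rightarrow> real) \<Rightarrow> nat \<Rightarrow> 'a measure" where
  "hist_alg M A R k = sigma (space M)
     ({A j -` B \<inter> space M | j B. j \<le> k \<and> B \<in> sets borel} \<union>
      {R j -` B \<inter> space M | j B. j < k \<and> B \<in> sets borel})"

definition regret :: "real^'n \<Rightarrow> (nat \<Rightarrow> real^'n) \<Rightarrow> nat \<Rightarrow> real" where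
  "regret \<theta> a T = (\<Sum>k<T. 1 - \<theta> \<bullet> a k)"

end

theory Submission
  imports Defs
begin

text \<open>
  Let \<open>C\<^sub>t\<close> be the event that the self-normalised noise after batch \<open>t\<close> is within the confidence radius.
  On \<open>C\<^sub>t\<close> the estimate is within \<open>\<beta>\<^sub>t / \<lambda>\<^sub>m\<^sub>i\<^sub>n(V\<^sub>t)\<close> of \<open>\<theta>\<close> in squared distance, hence so is, up to the factor
  4, every action of the next batch, in the sense that \<open>1 - \<langle>\<theta>, a\<rangle>\<^sup>2\<close> and \<open>1 - \<langle>\<theta>, a\<rangle>\<close> are at most
  \<open>4 \<beta>\<^sub>t / \<lambda>\<^sub>m\<^sub>i\<^sub>n(V\<^sub>t)\<close>. The tilted actions feed all but the top eigendirection of \<open>V\<^sub>t\<close>, and with the chosen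
  weights the invariant \<open>\<lambda>\<^sub>m\<^sub>i\<^sub>n\<^sup>2 \<ge> 2 / (3 (d - 1)) \<lambda>\<^sub>m\<^sub>a\<^sub>x\<close> is preserved. It makes the weights at most the
  inverse noise variances of the next batch, so the self-normalised exponential process, restricted to the
  intersection of the earlier \<open>C\<^sub>s\<close>, is a supermartingale, and Markov's inequality bounds the probability of
  leaving \<open>C\<^sub>t\<^sub>+\<^sub>1\<close> for the first time by \<open>\<delta>\<^sub>0\<close>. Finally the trace of \<open>V\<^sub>t\<close> satisfies
  \<open>\<tau>' = \<tau> + c \<surd>\<tau>\<close> up to constants, so \<open>\<lambda>\<^sub>m\<^sub>i\<^sub>n(V\<^sub>t)\<close> grows linearly in \<open>t\<close> and the regret is a harmonic sum.
\<close>

section \<open>Rank-one updates of positive definite matrices\<close>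

text \<open>The difficulty is a circle: a weight is fixed before its batch is played, must not
  exceed the inverse of a noise variance that depends on the unknown \<open>\<theta>\<close>, and
  the confidence statement that controls this variance is itself only valid for admissible weights.
  The eigenvalue part of the circle is cut by working pathwise: the invariant and the trace bounds
  hold for every reward sequence, so that chance enters through the events \<open>C\<^sub>t\<close>
  alone. The invariant is what links the two ends of the spectrum: the errors are measured by the
  smallest eigenvalue, while the weights are computed from the largest.

  A second obstacle is that the eigenvector choice \<open>E\<close> is an arbitrary function and may
  fail to be measurable. Measurability is therefore never derived from the formula for the actions
  but from the measurability of the played actions: the matrices are built from these and from the
  weights, and the weights from \<open>det\<close> and \<open>lam_max\<close>, which do not refer to
  \<open>E\<close>.\<close>

definition posdef :: "real^'n^'n \<Rightarrow> bool" where
  "posdef V \<longleftrightarrow> transpose V = V \<and> (\<forall>x. x \<noteq> 0 \<longrightarrow> 0 < x \<bullet> (V *v x))"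

lemma symmetric_dot:
  fixes V :: "real^'n^'n"
  assumes "transpose V = V"
  shows "x \<bullet> (V *v y) = (V *v x) \<bullet> y"
  by (metis assms dot_lmul_matrix vector_transpose_matrix)

lemma outer_mult_vec: "outer a b *v x = (b \<bullet> x) *\<^sub>R a"
  by (simp add: outer_def matrix_vector_mult_def inner_vec_def vec_eq_iff sum_distrib_left
      sum_distrib_right mult_ac)

lemma transpose_outer: "transpose (outer a b) = outer b a"
  by (simp add: outer_def transpose_def vec_eq_iff mult.commute)

lemma transpose_plus: "transpose (A + B) = transpose A + transpose (B :: real^'n^'m)"
  by (simp add: transpose_def vec_eq_iff)

lemma sum_matrix_mult_vec:
  "(sum f I :: real^'n^'m) *v x = (\<Sum>i\<in>I. f i *v x)"
  by (induction I rule: infinite_finite_induct) (auto simp: matrix_vector_mult_add_rdistrib)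

lemma scaleR_matrix_mult_vec: "(c *\<^sub>R A) *v x = c *\<^sub>R ((A :: real^'n^'m) *v x)"
  by (simp add: scaleR_matrix_vector_assoc)

lemma mat_mult_vec: "(mat c :: real^'n^'n) *v x = c *\<^sub>R x"
  by (simp add: mat_def matrix_vector_mult_def vec_eq_iff if_distrib[where f="\<lambda>x. x * _"] cong: if_cong)

lemma trace_scaleR: "trace (c *\<^sub>R A :: real^'n^'n) = c * trace A"
  by (simp add: trace_def sum_distrib_left)

lemma trace_outer: "trace (outer a b) = a \<bullet> b"
  by (simp add: trace_def outer_def inner_vec_def)

lemma trace_sum: "trace (sum f I :: real^'n^'n) = (\<Sum>i\<in>I. trace (f i))"
  by (simp add: trace_def sum.swap[of _ UNIV])

lemma posdef_symmetric: "posdef V \<Longrightarrow> transpose V = V"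
  by (simp add: posdef_def)

lemma posdef_invertible:
  assumes "posdef V"
  shows "invertible V"
proof -
  have "x = 0" if "V *v x = 0" for x
    using assms that unfolding posdef_def by (metis inner_zero_right less_irrefl)
  then show ?thesis
    by (metis invertible_left_inverse matrix_left_invertible_ker)
qed

lemma matrix_inv_right:
  fixes V :: "real^'n^'n"
  assumes "invertible V"
  shows "V ** matrix_inv V = mat 1"
proof -
  have "\<exists>B. V ** B = mat 1 \<and> B ** V = mat 1"
    using assms by (simp add: invertible_def)
  then show ?thesis
    unfolding matrix_inv_def by (rule someI2_ex) simp
qed

lemma mult_matrix_inv_vec:
  fixes V :: "real^'n^'n"
  assumes "posdef V"
  shows "V *v (matrix_inv V *v x) = x"
  by (simp add: matrix_vector_mul_assoc matrix_inv_right posdef_invertible assms)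

lemma matrix_inv_mult_vec:
  fixes V :: "real^'n^'n"
  assumes "posdef V"
  shows "matrix_inv V *v (V *v x) = x"
  by (metis assms matrix_inv_right matrix_left_right_inverse matrix_vector_mul_assoc
      matrix_vector_mul_lid posdef_invertible)

lemma matrix_inv_dot:
  assumes "posdef V"
  shows "x \<bullet> (matrix_inv V *v y) = (matrix_inv V *v x) \<bullet> y"
  using symmetric_dot[OF posdef_symmetric[OF assms], of "matrix_inv V *v x" "matrix_inv V *v y"]
  by (simp add: mult_matrix_inv_vec assms)

lemma matrix_inv_form_nonneg:
  assumes "posdef V"
  shows "0 \<le> x \<bullet> (matrix_inv V *v x)"
proof -
  let ?u = "matrix_inv V *v x"
  have "x \<bullet> ?u = ?u \<bullet> (V *v ?u)"
    by (simp add: mult_matrix_inv_vec assms inner_commute)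
  also have "\<dots> \<ge> 0"
    using assms by (cases "?u = 0") (auto simp: posdef_def intro: less_imp_le)
  finally show ?thesis .
qed

lemma posdef_add_outer:
  assumes "posdef V"
  shows "posdef (V + outer b b)"
  using assms unfolding posdef_def
  by (auto simp: transpose_plus transpose_outer matrix_vector_mult_add_rdistrib outer_mult_vec
      inner_add_right inner_commute add_pos_nonneg)

lemma posdef_mat: "0 < c \<Longrightarrow> posdef (mat c :: real^'n^'n)"
  by (auto simp: posdef_def mat_mult_vec)

text \<open>Sherman-Morrison at a single vector: instead of inverting the updated matrix, the
  solution of the linear system is exhibited. Half of the added fraction is the exponent in
  \<open>normal_mixture\<close>.\<close>

lemma matrix_inv_form_update:
  fixes V :: "real^'n^'n" and S b :: "real^'n" and \<eta> :: real
  assumes V: "posdef V"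
  defines "p \<equiv> b \<bullet> (matrix_inv V *v S)" and "q \<equiv> b \<bullet> (matrix_inv V *v b)"
  shows "(S + \<eta> *\<^sub>R b) \<bullet> (matrix_inv (V + outer b b) *v (S + \<eta> *\<^sub>R b))
    = S \<bullet> (matrix_inv V *v S) + (2 * p * \<eta> + q * \<eta>\<^sup>2 - p\<^sup>2) / (1 + q)"
proof -
  let ?z = "matrix_inv V *v S" and ?u = "matrix_inv V *v b"
  \<comment> \<open>The solution of \<open>c + p + c * q = \<eta>\<close>, the coefficient of
    \<open>b\<close> that the updated matrix must produce.\<close>
  let ?c = "(\<eta> - p) / (1 + q)"
  have q: "1 + q > 0"
    using matrix_inv_form_nonneg[OF V, of b] by (simp add: q_def)
  have "(V + outer b b) *v (?z + ?c *\<^sub>R ?u) = S + (?c + p + ?c * q) *\<^sub>R b"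
    using V by (simp add: matrix_vector_mult_add_rdistrib matrix_vector_right_distrib
        matrix_vector_mult_scaleR mult_matrix_inv_vec outer_mult_vec p_def q_def algebra_simps)
  also have "?c + p + ?c * q = \<eta>"
    using q by (simp add: divide_simps) (simp add: algebra_simps)
  finally have "matrix_inv (V + outer b b) *v (S + \<eta> *\<^sub>R b) = ?z + ?c *\<^sub>R ?u"
    using matrix_inv_mult_vec[OF posdef_add_outer[OF V, of b]] by metis
  moreover have "S \<bullet> ?u = p"
    using matrix_inv_dot[OF V, of S b] by (simp add: p_def inner_commute)
  ultimately have "(S + \<eta> *\<^sub>R b) \<bullet> (matrix_inv (V + outer b b) *v (S + \<eta> *\<^sub>R b))
      = S \<bullet> ?z + (\<eta> * p + ?c * (p + \<eta> * q))"
    by (simp add: inner_add_left inner_add_right p_def q_def algebra_simps)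
  also have "\<eta> * p + ?c * (p + \<eta> * q) = (2 * p * \<eta> + q * \<eta>\<^sup>2 - p\<^sup>2) / (1 + q)"
    using q by (simp add: divide_simps) (simp add: algebra_simps power2_eq_square)
  finally show ?thesis .
qed

lemma det_orthogonal_conj:
  fixes Q V :: "real^'n^'n"
  assumes "orthogonal_matrix Q"
  shows "det (transpose Q ** V ** Q) = det V"
proof -
  have "det Q * det Q = 1"
    using det_orthogonal_matrix[OF assms] by auto
  then show ?thesis
    by (simp add: det_mul det_transpose algebra_simps)
qed

lemma det_add_outer_axis:
  fixes W :: "real^'n^'n"
  assumes x: "W *v x = axis k 1"
  shows "det (W + c *\<^sub>R outer (axis k 1) (axis k 1)) = (1 + c * x $ k) * det W"
proof -
  \<comment> \<open>Chosen so that \<open>W *v ?y\<close> is the changed column; replacing column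
    \<open>k\<close> by it multiplies the determinant by \<open>?y $ k\<close>.\<close>
  let ?y = "axis k 1 + c *\<^sub>R x"
  have "W *v ?y = column k W + c *\<^sub>R axis k 1"
    by (simp add: matrix_vector_right_distrib matrix_vector_mult_scaleR x matrix_vector_mult_basis)
  then have "W + c *\<^sub>R outer (axis k 1) (axis k 1) = (\<chi> i j. if j = k then (W *v ?y) $ i else W $ i $ j)"
    by (simp add: vec_eq_iff outer_def column_def axis_def)
  then show ?thesis
    using cramer_lemma[of k W ?y] by (simp add: axis_def)
qed

text \<open>An orthogonal change of basis takes \<open>b\<close> to a multiple of a basis vector; there the update
  changes a single column, and Cramer's rule gives the determinant.\<close>
lemma det_add_outer:
  fixes V :: "real^'n^'n"
  assumes V: "posdef V"
  shows "det (V + outer b b) = (1 + b \<bullet> (matrix_inv V *v b)) * det V"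
proof (cases "b = 0")
  case True
  then have "outer b b = 0"
    by (simp add: outer_def vec_eq_iff)
  then show ?thesis
    using True by simp
next
  case False
  \<comment> \<open>The coordinate to which \<open>b\<close> is rotated is arbitrary;
    \<open>undefined\<close> just names one.\<close>
  let ?e = "b /\<^sub>R norm b" and ?k = "undefined :: 'n"
  have "norm ?e = 1"
    using False by simp
  then obtain Q where Q: "orthogonal_matrix Q" "Q *v axis ?k 1 = ?e"
    using orthogonal_matrix_exists_basis by metis
  have QQ: "transpose Q ** Q = mat 1" "Q ** transpose Q = mat 1"
    using Q(1) by (auto simp: orthogonal_matrix_def)
  have b: "b = norm b *\<^sub>R (Q *v axis ?k 1)"
    using Q(2) False by simp
  have Qb: "transpose Q *v b = norm b *\<^sub>R axis ?k 1"
    by (subst b) (simp only: matrix_vector_mult_scaleR matrix_vector_mul_assoc QQ matrix_vector_mul_lid)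
  let ?W = "transpose Q ** V ** Q"
  let ?x = "transpose Q *v (matrix_inv V *v (Q *v axis ?k 1))"
  have Wx: "?W *v ?x = axis ?k 1"
  proof -
    have "?W *v ?x = transpose Q *v (V *v ((Q ** transpose Q) *v (matrix_inv V *v (Q *v axis ?k 1))))"
      by (simp only: matrix_vector_mul_assoc matrix_mul_assoc)
    also have "\<dots> = transpose Q *v (Q *v axis ?k 1)"
      by (simp only: QQ matrix_vector_mul_lid mult_matrix_inv_vec[OF V])
    finally show ?thesis by (simp only: matrix_vector_mul_assoc QQ matrix_vector_mul_lid)
  qed
  have "transpose Q ** (V + outer b b) ** Q
      = ?W + (norm b)\<^sup>2 *\<^sub>R outer (axis ?k 1) (axis ?k 1)"
  proof -
    have "(transpose Q ** (V + outer b b) ** Q) *v y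
      = (?W + (norm b)\<^sup>2 *\<^sub>R outer (axis ?k 1) (axis ?k 1)) *v y" for y
    proof -
      have "b \<bullet> (Q *v y) = (transpose Q *v b) \<bullet> y"
        by (metis dot_lmul_matrix transpose_matrix_vector)
      then have "b \<bullet> (Q *v y) = norm b * (axis ?k 1 \<bullet> y)"
        by (simp add: Qb del: transpose_matrix_vector)
      then show ?thesis
        using Qb by (simp add: matrix_vector_mul_assoc[symmetric] matrix_vector_mult_add_rdistrib
            matrix_vector_right_distrib outer_mult_vec matrix_vector_mult_scaleR
            scaleR_matrix_mult_vec power2_eq_square mult_ac del: transpose_matrix_vector)
    qed
    then show ?thesis
      by (simp add: matrix_eq)
  qed
  then have "det (V + outer b b) = (1 + (norm b)\<^sup>2 * ?x $ ?k) * det V"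
    using det_orthogonal_conj[OF Q(1), of "V + outer b b"] det_orthogonal_conj[OF Q(1), of V]
      det_add_outer_axis[OF Wx, of "(norm b)\<^sup>2"] by simp
  also have "(norm b)\<^sup>2 * ?x $ ?k = b \<bullet> (matrix_inv V *v b)"
  proof -
    have "b \<bullet> (matrix_inv V *v b) = (norm b)\<^sup>2 * ((Q *v axis ?k 1) \<bullet> (matrix_inv V *v (Q *v axis ?k 1)))"
      by (subst b, subst (2) b) (simp add: matrix_vector_mult_scaleR power2_eq_square)
    also have "(Q *v axis ?k 1) \<bullet> (matrix_inv V *v (Q *v axis ?k 1)) = axis ?k 1 \<bullet> ?x"
      by (metis dot_lmul_matrix vector_transpose_matrix)
    also have "\<dots> = ?x $ ?k"
      by (simp add: inner_axis' del: transpose_matrix_vector)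
    finally show ?thesis by simp
  qed
  finally show ?thesis .
qed

section \<open>Spectral facts for eigenvector selectors\<close>

lemma eig_selector_orthonormal:
  fixes V :: "real^'n^'n" and E :: "real^'n^'n \<Rightarrow> nat \<Rightarrow> real^'n"
  assumes "eig_selector E" "transpose V = V" "i \<in> {1..CARD('n)}" "j \<in> {1..CARD('n)}"
  shows "E V i \<bullet> E V j = (if i = j then 1 else 0)"
  using assms unfolding eig_selector_def by blast

lemma eig_selector_eigen:
  fixes V :: "real^'n^'n" and E :: "real^'n^'n \<Rightarrow> nat \<Rightarrow> real^'n"
  assumes "eig_selector E" "transpose V = V" "i \<in> {1..CARD('n)}"
  shows "V *v E V i = eigval E V i *\<^sub>R E V i"
  using assms unfolding eig_selector_def eigval_def by blast

lemma eig_selector_mono: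
  fixes V :: "real^'n^'n" and E :: "real^'n^'n \<Rightarrow> nat \<Rightarrow> real^'n"
  assumes "eig_selector E" "transpose V = V" "1 \<le> i" "i \<le> j" "j \<le> CARD('n)"
  shows "eigval E V i \<le> eigval E V j"
  using assms unfolding eig_selector_def eigval_def by auto

text \<open>Moves the numbering \<open>1..d\<close> of the eigenvectors to the index type by a
  bijection. The order of the eigenvalues is lost, but sums and products over the spectrum do not
  depend on it.\<close>

lemma eig_selector_matrix:
  fixes V :: "real^'n^'n" and E :: "real^'n^'n \<Rightarrow> nat \<Rightarrow> real^'n"
  assumes E: "eig_selector E" and V: "transpose V = V"
  obtains f Q where "bij_betw f (UNIV :: 'n set) {1..CARD('n)}" "orthogonal_matrix Q"
    "\<And>i. row i Q = E V (f i)"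
    "Q ** V ** transpose Q = (\<chi> i j. if i = j then eigval E V (f i) else 0)"
proof -
  obtain f where f: "bij_betw f (UNIV :: 'n set) {1..CARD('n)}"
    by (metis ex_bij_betw_finite_nat finite_class.finite_UNIV ex_bij_betw_nat_finite_1 bij_betw_inv)
  then have fin: "f i \<in> {1..CARD('n)}" for i
    by (auto simp: bij_betw_def)
  have finj: "f i = f j \<longleftrightarrow> i = j" for i j
    using f by (auto simp: bij_betw_def inj_on_def)
  define Q :: "real^'n^'n" where "Q = (\<chi> i. E V (f i))"
  have row: "row i Q = E V (f i)" for i
    by (simp add: row_def Q_def vec_eq_iff)
  have "orthogonal_matrix Q"
    unfolding orthogonal_matrix_orthonormal_rows
    using eig_selector_orthonormal[OF E V fin fin] by (simp add: row finj norm_eq_1 orthogonal_def)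
  moreover have "Q ** V ** transpose Q = (\<chi> i j. if i = j then eigval E V (f i) else 0)"
  proof -
    have "(Q ** V ** transpose Q) $ i $ j = (if i = j then eigval E V (f i) else 0)" for i j
    proof -
      have "(Q ** V ** transpose Q) $ i $ j = E V (f i) \<bullet> (V *v E V (f j))"
        by (simp add: matrix_mul_assoc[symmetric])
           (simp add: matrix_matrix_mult_def matrix_vector_mult_def inner_vec_def transpose_def Q_def)
      then show ?thesis
        using eig_selector_eigen[OF E V fin] eig_selector_orthonormal[OF E V fin fin]
        by (simp add: finj)
    qed
    then show ?thesis
      by (simp add: vec_eq_iff)
  qed
  ultimately show ?thesis
    using that f row by blast
qed

text \<open>Parseval's identity: the matrix with the eigenvectors as rows preserves inner
  products.\<close>

lemma eig_selector_inner:
  fixes V :: "real^'n^'n" and E :: "real^'n^'n \<Rightarrow> nat \<Rightarrow> real^'n"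
  assumes E: "eig_selector E" and V: "transpose V = V"
  shows "x \<bullet> y = (\<Sum>i\<in>{1..CARD('n)}. (E V i \<bullet> x) * (E V i \<bullet> y))"
proof -
  obtain f Q where f: "bij_betw f (UNIV :: 'n set) {1..CARD('n)}" and Q: "orthogonal_matrix Q"
    and row: "\<And>i. row i Q = E V (f i)"
    using eig_selector_matrix[OF E V] by blast
  have comp: "(Q *v z) $ i = E V (f i) \<bullet> z" for z i
    by (simp add: row[symmetric] matrix_vector_mult_def row_def inner_vec_def)
  have "x \<bullet> y = (Q *v x) \<bullet> (Q *v y)"
    using Q unfolding orthogonal_matrix_def
    by (metis dot_lmul_matrix matrix_vector_mul_assoc matrix_vector_mul_lid vector_transpose_matrix
        transpose_matrix_vector)
  also have "\<dots> = (\<Sum>i\<in>UNIV. (E V (f i) \<bullet> x) * (E V (f i) \<bullet> y))"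
    by (simp add: inner_vec_def comp)
  also have "\<dots> = (\<Sum>i\<in>{1..CARD('n)}. (E V i \<bullet> x) * (E V i \<bullet> y))"
    by (rule sum.reindex_bij_betw[OF f])
  finally show ?thesis .
qed

lemma eig_selector_form:
  fixes V :: "real^'n^'n" and E :: "real^'n^'n \<Rightarrow> nat \<Rightarrow> real^'n"
  assumes E: "eig_selector E" and V: "transpose V = V"
  shows "x \<bullet> (V *v x) = (\<Sum>i\<in>{1..CARD('n)}. eigval E V i * (E V i \<bullet> x)\<^sup>2)"
proof -
  have "E V i \<bullet> (V *v x) = eigval E V i * (E V i \<bullet> x)" if "i \<in> {1..CARD('n)}" for i
    using symmetric_dot[OF V, of "E V i" x] eig_selector_eigen[OF E V that] by simp
  then show ?thesis
    using eig_selector_inner[OF E V, of x "V *v x"] by (simp add: power2_eq_square mult_ac)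
qed

lemma det_eq_prod_eigval:
  fixes V :: "real^'n^'n" and E :: "real^'n^'n \<Rightarrow> nat \<Rightarrow> real^'n"
  assumes E: "eig_selector E" and V: "transpose V = V"
  shows "det V = (\<Prod>i\<in>{1..CARD('n)}. eigval E V i)"
proof -
  obtain f Q where f: "bij_betw f (UNIV :: 'n set) {1..CARD('n)}" and Q: "orthogonal_matrix Q"
    and "\<And>i. row i Q = E V (f i)"
    and D: "Q ** V ** transpose Q = (\<chi> i j. if i = j then eigval E V (f i) else 0)"
    using eig_selector_matrix[OF E V] by blast
  have "det V = det (Q ** V ** transpose Q)"
    using det_orthogonal_conj[of "transpose Q" V] Q by simp
  also have "\<dots> = (\<Prod>i\<in>UNIV. eigval E V (f i))"
    by (subst det_diagonal) (simp_all add: D)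
  also have "\<dots> = (\<Prod>i\<in>{1..CARD('n)}. eigval E V i)"
    by (rule prod.reindex_bij_betw[OF f])
  finally show ?thesis .
qed

lemma trace_eq_sum_eigval:
  fixes V :: "real^'n^'n" and E :: "real^'n^'n \<Rightarrow> nat \<Rightarrow> real^'n"
  assumes E: "eig_selector E" and V: "transpose V = V"
  shows "trace V = (\<Sum>i\<in>{1..CARD('n)}. eigval E V i)"
proof -
  obtain f Q where f: "bij_betw f (UNIV :: 'n set) {1..CARD('n)}" and Q: "orthogonal_matrix Q"
    and "\<And>i. row i Q = E V (f i)"
    and D: "Q ** V ** transpose Q = (\<chi> i j. if i = j then eigval E V (f i) else 0)"
    using eig_selector_matrix[OF E V] by blast
  have "trace V = trace (Q ** V ** transpose Q)"
    using Q trace_mul_sym[of "Q ** V" "transpose Q"]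
    by (simp add: matrix_mul_assoc orthogonal_matrix_def)
  also have "\<dots> = (\<Sum>i\<in>UNIV. eigval E V (f i))"
    by (simp add: D trace_def)
  also have "\<dots> = (\<Sum>i\<in>{1..CARD('n)}. eigval E V i)"
    by (rule sum.reindex_bij_betw[OF f])
  finally show ?thesis .
qed

text \<open>Shows that the \<open>Max\<close> in \<open>lam_max\<close> ranges over a finite
  nonempty set.\<close>

lemma eigvals_eq:
  fixes V :: "real^'n^'n" and E :: "real^'n^'n \<Rightarrow> nat \<Rightarrow> real^'n"
  assumes E: "eig_selector E" and V: "transpose V = V"
  shows "eigvals V = eigval E V ` {1..CARD('n)}"
proof (intro equalityI subsetI)
  fix l assume "l \<in> eigvals V"
  then obtain v where v: "v \<noteq> 0" "V *v v = l *\<^sub>R v"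
    by (auto simp: eigvals_def)
  have "\<exists>i\<in>{1..CARD('n)}. E V i \<bullet> v \<noteq> 0"
    using eig_selector_inner[OF E V, of v v] v(1) by (metis (no_types, lifting) inner_eq_zero_iff mult_zero_left sum.neutral)
  then obtain i where i: "i \<in> {1..CARD('n)}" "E V i \<bullet> v \<noteq> 0"
    by blast
  have "l * (E V i \<bullet> v) = eigval E V i * (E V i \<bullet> v)"
    using symmetric_dot[OF V, of "E V i" v] eig_selector_eigen[OF E V i(1)] v(2) by simp
  then show "l \<in> eigval E V ` {1..CARD('n)}"
    using i by auto
next
  fix l assume "l \<in> eigval E V ` {1..CARD('n)}"
  then obtain i where i: "i \<in> {1..CARD('n)}" "l = eigval E V i"
    by blast
  moreover have "E V i \<noteq> 0"
    using eig_selector_orthonormal[OF E V i(1) i(1)] by auto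
  ultimately show "l \<in> eigvals V"
    using eig_selector_eigen[OF E V i(1)] by (auto simp: eigvals_def)
qed

lemma lam_max_eq_eigval:
  fixes V :: "real^'n^'n" and E :: "real^'n^'n \<Rightarrow> nat \<Rightarrow> real^'n"
  assumes E: "eig_selector E" and V: "transpose V = V"
  shows "lam_max V = eigval E V CARD('n)"
  unfolding lam_max_def eigvals_eq[OF E V]
proof (rule Max_eqI)
  show "y \<le> eigval E V CARD('n)" if "y \<in> eigval E V ` {1..CARD('n)}" for y
    using that by (auto intro: eig_selector_mono[OF E V])
qed auto

lemma eigval_1_form_le:
  fixes V :: "real^'n^'n" and E :: "real^'n^'n \<Rightarrow> nat \<Rightarrow> real^'n"
  assumes E: "eig_selector E" and V: "transpose V = V"
  shows "eigval E V 1 * (x \<bullet> x) \<le> x \<bullet> (V *v x)"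
  unfolding eig_selector_form[OF E V] eig_selector_inner[OF E V, of x x] sum_distrib_left
  by (rule sum_mono) (auto simp: power2_eq_square intro!: mult_right_mono eig_selector_mono[OF E V])

lemma form_le_lam_max:
  fixes V :: "real^'n^'n" and E :: "real^'n^'n \<Rightarrow> nat \<Rightarrow> real^'n"
  assumes E: "eig_selector E" and V: "transpose V = V"
  shows "x \<bullet> (V *v x) \<le> lam_max V * (x \<bullet> x)"
  unfolding lam_max_eq_eigval[OF E V] eig_selector_form[OF E V] eig_selector_inner[OF E V, of x x]
    sum_distrib_left
  by (rule sum_mono) (auto simp: power2_eq_square intro!: mult_right_mono eig_selector_mono[OF E V])

lemma eigval_1_greatest:
  fixes V :: "real^'n^'n" and E :: "real^'n^'n \<Rightarrow> nat \<Rightarrow> real^'n"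
  assumes E: "eig_selector E" and V: "transpose V = V" and c: "\<And>x. c * (x \<bullet> x) \<le> x \<bullet> (V *v x)"
  shows "c \<le> eigval E V 1"
proof -
  have "E V 1 \<bullet> E V 1 = 1"
    using eig_selector_orthonormal[OF E V, of 1 1] by (simp add: Suc_leI)
  then show ?thesis
    using c[of "E V 1"] by (simp add: eigval_def)
qed

text \<open>For fixed \<open>c\<close> the right side is a family of linear constraints on
  \<open>V\<close>. This form yields both the growth bound for the largest eigenvalue and its
  measurability.\<close>

lemma lam_max_le_iff:
  fixes V :: "real^'n^'n" and E :: "real^'n^'n \<Rightarrow> nat \<Rightarrow> real^'n"
  assumes E: "eig_selector E" and V: "transpose V = V"
  shows "lam_max V \<le> c \<longleftrightarrow> (\<forall>x. x \<bullet> (V *v x) \<le> c * (x \<bullet> x))"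
proof
  assume "lam_max V \<le> c"
  then show "\<forall>x. x \<bullet> (V *v x) \<le> c * (x \<bullet> x)"
    using form_le_lam_max[OF E V] by (meson inner_ge_zero mult_right_mono order_trans)
next
  assume c: "\<forall>x. x \<bullet> (V *v x) \<le> c * (x \<bullet> x)"
  have "E V CARD('n) \<bullet> E V CARD('n) = 1"
    using eig_selector_orthonormal[OF E V, of "CARD('n)" "CARD('n)"] by (simp add: Suc_leI)
  then show "lam_max V \<le> c"
    using c[rule_format, of "E V CARD('n)"] by (simp add: eigval_def lam_max_eq_eigval[OF E V])
qed

lemma eigval_1_pos:
  fixes V :: "real^'n^'n" and E :: "real^'n^'n \<Rightarrow> nat \<Rightarrow> real^'n"
  assumes E: "eig_selector E" and V: "posdef V"
  shows "eigval E V 1 > 0"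
proof -
  have "E V 1 \<bullet> E V 1 = 1"
    using eig_selector_orthonormal[OF E posdef_symmetric[OF V], of 1 1] by (simp add: Suc_leI)
  then have "E V 1 \<noteq> 0"
    by auto
  then show ?thesis
    using V by (simp add: posdef_def eigval_def)
qed

lemma eigval_pos:
  fixes V :: "real^'n^'n" and E :: "real^'n^'n \<Rightarrow> nat \<Rightarrow> real^'n"
  assumes "eig_selector E" "posdef V" "i \<in> {1..CARD('n)}"
  shows "eigval E V i > 0"
  using eigval_1_pos[OF assms(1,2)] eig_selector_mono[OF assms(1) posdef_symmetric[OF assms(2)], of 1 i] assms(3)
  by simp

lemma posdef_det_pos:
  fixes V :: "real^'n^'n" and E :: "real^'n^'n \<Rightarrow> nat \<Rightarrow> real^'n"
  assumes E: "eig_selector E" and V: "posdef V"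
  shows "det V > 0"
  unfolding det_eq_prod_eigval[OF E posdef_symmetric[OF V]]
  by (rule prod_pos) (use eigval_pos[OF E V] in blast)

lemma lam_max_le_trace:
  fixes V :: "real^'n^'n" and E :: "real^'n^'n \<Rightarrow> nat \<Rightarrow> real^'n"
  assumes E: "eig_selector E" and V: "posdef V"
  shows "lam_max V \<le> trace V"
  unfolding lam_max_eq_eigval[OF E posdef_symmetric[OF V]] trace_eq_sum_eigval[OF E posdef_symmetric[OF V]]
  by (rule member_le_sum) (auto simp: Suc_leI intro!: less_imp_le[OF eigval_pos[OF E V]])

lemma trace_le_lam_max:
  fixes V :: "real^'n^'n" and E :: "real^'n^'n \<Rightarrow> nat \<Rightarrow> real^'n"
  assumes E: "eig_selector E" and V: "transpose V = V"
  shows "trace V \<le> CARD('n) * lam_max V"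
  unfolding lam_max_eq_eigval[OF E V] trace_eq_sum_eigval[OF E V]
  by (rule order_trans[OF sum_bounded_above[where K = "eigval E V CARD('n)"]]) (auto intro: eig_selector_mono[OF E V])

text \<open>By \<open>ln x \<le> x - 1\<close> at the eigenvalues divided by their mean.\<close>
lemma ln_det_le:
  fixes V :: "real^'n^'n" and E :: "real^'n^'n \<Rightarrow> nat \<Rightarrow> real^'n"
  assumes E: "eig_selector E" and V: "posdef V"
  shows "ln (det V) \<le> CARD('n) * ln (trace V / CARD('n))"
proof -
  let ?I = "{1..CARD('n)}"
  note sym = posdef_symmetric[OF V]
  have pos: "eigval E V i > 0" if "i \<in> ?I" for i
    using eigval_pos[OF E V that] .
  define y where "y = trace V / CARD('n)"
  have y: "y > 0"
    unfolding y_def trace_eq_sum_eigval[OF E sym]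
    by (auto intro!: divide_pos_pos sum_pos pos simp: Suc_leI)
  have "ln (det V) = (\<Sum>i\<in>?I. ln (eigval E V i))"
    unfolding det_eq_prod_eigval[OF E sym] by (rule ln_prod) (use pos in force)+
  also have "\<dots> \<le> (\<Sum>i\<in>?I. ln y + (eigval E V i / y - 1))"
  proof (rule sum_mono)
    fix i assume "i \<in> ?I"
    then show "ln (eigval E V i) \<le> ln y + (eigval E V i / y - 1)"
      using ln_le_minus_one[of "eigval E V i / y"] pos[of i] y by (simp add: ln_div)
  qed
  also have "\<dots> = CARD('n) * ln y + (trace V / y - CARD('n))"
    by (simp add: sum.distrib sum_subtractf trace_eq_sum_eigval[OF E sym] sum_divide_distrib)
  also have "trace V / y = CARD('n)"
    using y by (simp add: y_def field_simps)
  finally show ?thesis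
    by (simp add: y_def)
qed

text \<open>The triangle inequality for the norm induced by \<open>V\<close>. Its Cauchy-Schwarz
  part comes from the positivity of the form at \<open>b *\<^sub>R x + a *\<^sub>R y\<close>,
  divided by \<open>2 * a * b\<close>, whence the separate case \<open>a = 0\<close>.\<close>

lemma posdef_form_triangle:
  fixes V :: "real^'n^'n"
  assumes V: "posdef V" and x: "x \<bullet> (V *v x) \<le> a\<^sup>2" and y: "y \<bullet> (V *v y) \<le> b\<^sup>2"
    and ab: "0 \<le> a" "0 < b"
  shows "(x - y) \<bullet> (V *v (x - y)) \<le> (a + b)\<^sup>2"
proof -
  have nonneg: "0 \<le> z \<bullet> (V *v z)" for z
    using V by (cases "z = 0") (auto simp: posdef_def intro: less_imp_le)
  have *: "0 \<le> b\<^sup>2 * (x \<bullet> (V *v x)) + 2 * a * b * (x \<bullet> (V *v y)) + a\<^sup>2 * (y \<bullet> (V *v y))"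
    using nonneg[of "b *\<^sub>R x + a *\<^sub>R y"] symmetric_dot[OF posdef_symmetric[OF V], of y x]
    by (simp add: matrix_vector_right_distrib matrix_vector_mult_scaleR inner_add_left
        inner_add_right algebra_simps power2_eq_square inner_commute)
  have bound: "- (x \<bullet> (V *v y)) \<le> a * b"
  proof (cases "a = 0")
    case True
    then have "x \<bullet> (V *v x) \<le> 0"
      using x by simp
    then have "x = 0"
      using V unfolding posdef_def by (meson not_less)
    then show ?thesis
      using True by simp
  next
    case False
    have "b\<^sup>2 * (x \<bullet> (V *v x)) \<le> b\<^sup>2 * a\<^sup>2" "a\<^sup>2 * (y \<bullet> (V *v y)) \<le> a\<^sup>2 * b\<^sup>2"
      using x y by (auto intro: mult_left_mono)
    with * have "0 \<le> (2 * a * b) * (x \<bullet> (V *v y) + a * b)"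
      by (simp add: algebra_simps power2_eq_square)
    moreover have "0 < 2 * a * b"
      using ab False by simp
    ultimately have "0 \<le> x \<bullet> (V *v y) + a * b"
      by (metis mult_pos_neg not_less)
    then show ?thesis by simp
  qed
  have "(x - y) \<bullet> (V *v (x - y)) = x \<bullet> (V *v x) + y \<bullet> (V *v y) - 2 * (x \<bullet> (V *v y))"
    using symmetric_dot[OF posdef_symmetric[OF V], of y x]
    by (simp add: matrix_vector_mult_diff_distrib inner_diff_left inner_diff_right inner_commute)
  then show ?thesis
    using x y bound by (simp add: power2_sum)
qed

section \<open>Geometry of the tilted actions\<close>

lemma unit_diff_scaleR:
  fixes x a :: "'a::real_inner"
  assumes "norm x = 1"
  shows "(norm (x - c *\<^sub>R a))\<^sup>2 = 1 - 2 * c * (x \<bullet> a) + c\<^sup>2 * (norm a)\<^sup>2"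
  unfolding power2_norm_eq_inner
  using assms by (simp add: inner_diff_left inner_diff_right norm_eq_1 inner_commute power2_eq_square algebra_simps)

text \<open>The left side is the squared distance of \<open>x\<close> from the line through
  \<open>a\<close>, and \<open>c *\<^sub>R a\<close> is a point of this line.\<close>

lemma one_minus_inner_sq_le:
  fixes x a :: "'a::real_inner"
  assumes "norm x = 1" "norm a = 1"
  shows "1 - (x \<bullet> a)\<^sup>2 \<le> (norm (x - c *\<^sub>R a))\<^sup>2"
  unfolding unit_diff_scaleR[OF assms(1)] assms(2)
  using zero_le_power2[of "c - x \<bullet> a"] by (simp add: power2_diff algebra_simps)

context
  fixes \<tau> v :: "'a::real_inner" and L s :: real
  assumes v: "norm v = 1" and s: "\<bar>s\<bar> = 1" and L: "L \<ge> 2"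
begin

private abbreviation (input) "thw \<equiv> (1 / norm \<tau>) *\<^sub>R \<tau>"
private abbreviation (input) "ta \<equiv> thw + (s / sqrt L) *\<^sub>R v"
private abbreviation (input) "act \<equiv> (1 / norm ta) *\<^sub>R ta"

text \<open>Since \<open>1 / 0 = 0\<close>, normalising a vanishing estimate gives the zero vector;
  this case is carried along.\<close>

private lemma thw_cases: "\<tau> = 0 \<or> norm thw = 1"
  by simp

private lemma step_norm: "norm ((s / sqrt L) *\<^sub>R v) = 1 / sqrt L" "0 < 1 / sqrt L" "1 / sqrt L < 1"
  using v s L by (auto simp: abs_divide real_less_rsqrt)

text \<open>The centre has norm 0 or 1, the tilt a norm strictly between, so they cannot
  cancel.\<close>

lemma tilted_nonzero: "ta \<noteq> 0"
proof
  assume "ta = 0"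
  then have "norm thw = norm ((s / sqrt L) *\<^sub>R v)"
    by (metis add_eq_0_iff norm_minus_cancel)
  then show False
    using thw_cases step_norm by auto
qed

text \<open>Origin of the 3 in \<open>ba_sq_ge\<close> and hence in the invariant. From
  \<open>1 / sqrt L \<le> 3 / 4\<close> and \<open>1 / L \<le> 1 / 2\<close> the square is at most
  \<open>1 + 3 / 2 + 1 / 2\<close>.\<close>

lemma tilted_norm: "(norm ta)\<^sup>2 \<le> 3"
proof -
  have sqrt_L: "4 / 3 \<le> sqrt L"
    by (rule real_le_rsqrt) (use L in \<open>simp add: power2_eq_square\<close>)
  have "norm ta \<le> 1 + 1 / sqrt L"
    using norm_triangle_ineq[of thw "(s / sqrt L) *\<^sub>R v"] step_norm(1) thw_cases by auto
  then have "(norm ta)\<^sup>2 \<le> (1 + 1 / sqrt L)\<^sup>2"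
    by (rule power_mono) simp
  also have "\<dots> = 1 + 2 * (1 / sqrt L) + 1 / L"
    using L by (simp add: power2_sum power_divide)
  also have "1 / sqrt L \<le> 3 / 4"
    using sqrt_L L by (simp add: divide_le_eq)
  also have "1 / L \<le> 1 / 2"
    using L by simp
  finally show ?thesis by simp
qed

context
  fixes \<theta> :: 'a and \<beta> :: real
  assumes \<theta>: "norm \<theta> = 1" and \<beta>: "\<beta> \<ge> 1" and close: "L * (norm (\<tau> - \<theta>))\<^sup>2 \<le> \<beta>"
begin

private lemma err: "(norm (\<theta> - \<tau>))\<^sup>2 \<le> \<beta> / L"
  using close L by (simp add: field_simps norm_minus_commute)

text \<open>The estimate itself lies on the line spanned by its normalisation. If it vanishes, the
  error is 1 and the bound is trivial.\<close>

private lemma center: "1 - (\<theta> \<bullet> thw)\<^sup>2 \<le> \<beta> / L"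
proof (cases "\<tau> = 0")
  case True
  then show ?thesis using err \<theta> by simp
next
  case False
  then have "1 - (\<theta> \<bullet> thw)\<^sup>2 \<le> (norm (\<theta> - norm \<tau> *\<^sub>R thw))\<^sup>2"
    by (intro one_minus_inner_sq_le \<theta>) simp
  then show ?thesis using err False by simp
qed

text \<open>With \<open>?c = \<theta> \<bullet> thw\<close>, the point
  \<open>?c *\<^sub>R ta\<close> of the line through the action differs from \<open>\<theta>\<close>
  by the residual of projecting \<open>\<theta>\<close> to the centre and by a scaled tilt. Both
  have squared norm at most \<open>\<beta> / L\<close>, and squaring the sum costs a factor 2 on
  each.\<close>

lemma tilted_angle: "1 - (\<theta> \<bullet> act)\<^sup>2 \<le> 4 * \<beta> / L"
proof -
  let ?c = "\<theta> \<bullet> thw"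
  have "1 - (\<theta> \<bullet> act)\<^sup>2 \<le> (norm (\<theta> - (?c * norm ta) *\<^sub>R act))\<^sup>2"
    using tilted_nonzero by (intro one_minus_inner_sq_le \<theta>) simp
  also have "\<theta> - (?c * norm ta) *\<^sub>R act = (\<theta> - ?c *\<^sub>R thw) - ?c *\<^sub>R (s / sqrt L) *\<^sub>R v"
    using tilted_nonzero by (simp add: algebra_simps)
  also have "(norm \<dots>)\<^sup>2 \<le> (norm (\<theta> - ?c *\<^sub>R thw) + norm (?c *\<^sub>R (s / sqrt L) *\<^sub>R v))\<^sup>2"
    by (intro power_mono norm_triangle_ineq4) simp
  also have "\<dots> \<le> 2 * (norm (\<theta> - ?c *\<^sub>R thw))\<^sup>2 + 2 * (norm (?c *\<^sub>R (s / sqrt L) *\<^sub>R v))\<^sup>2"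
    using zero_le_power2[of "norm (\<theta> - ?c *\<^sub>R thw) - norm (?c *\<^sub>R (s / sqrt L) *\<^sub>R v)"]
    by (simp add: power2_sum power2_diff)
  also have "(norm (\<theta> - ?c *\<^sub>R thw))\<^sup>2 \<le> \<beta> / L"
  proof -
    have "(norm (\<theta> - ?c *\<^sub>R thw))\<^sup>2 = 1 - ?c\<^sup>2"
      unfolding unit_diff_scaleR[OF \<theta>]
      using thw_cases by (auto simp: power2_eq_square)
    then show ?thesis using center by simp
  qed
  also have "(norm (?c *\<^sub>R (s / sqrt L) *\<^sub>R v))\<^sup>2 \<le> \<beta> / L"
  proof -
    have "\<bar>?c\<bar> \<le> norm \<theta> * norm thw"
      by (rule Cauchy_Schwarz_ineq2)
    also have "\<dots> \<le> 1"
      using thw_cases \<theta> by auto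
    finally have "?c\<^sup>2 \<le> 1"
      by (simp add: abs_square_le_1)
    then have "?c\<^sup>2 * (1 / L) \<le> 1 * (1 / L)"
      using L by (intro mult_right_mono) auto
    moreover have "(norm (?c *\<^sub>R (s / sqrt L) *\<^sub>R v))\<^sup>2 = ?c\<^sup>2 * (1 / L)"
      unfolding norm_scaleR[of ?c] step_norm(1) using L by (simp add: power_mult_distrib power_divide)
    moreover have "1 / L \<le> \<beta> / L"
      using L \<beta> by (simp add: divide_right_mono)
    ultimately show ?thesis by simp
  qed
  finally show ?thesis by simp
qed

text \<open>The bound on \<open>1 - (\<theta> \<bullet> act)\<^sup>2\<close> says nothing about the sign of \<open>\<theta> \<bullet> act\<close>; a negative sign forces
  \<open>L < \<beta> + 1\<close>, in which case the claim is trivial.\<close>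
lemma tilted_regret: "1 - \<theta> \<bullet> act \<le> 4 * \<beta> / L"
proof -
  have "\<bar>\<theta> \<bullet> act\<bar> \<le> norm \<theta> * norm act"
    by (rule Cauchy_Schwarz_ineq2)
  then have le1: "\<bar>\<theta> \<bullet> act\<bar> \<le> 1"
    using tilted_nonzero \<theta> by simp
  show ?thesis
  proof (cases "\<theta> \<bullet> act \<ge> 0")
    case True
    have "z\<^sup>2 \<le> z" if "0 \<le> z" "\<bar>z\<bar> \<le> 1" for z :: real
      using that by (simp add: power2_eq_square mult_left_le)
    from this[OF True le1] have "(\<theta> \<bullet> act)\<^sup>2 \<le> \<theta> \<bullet> act" .
    then show ?thesis using tilted_angle by linarith
  next
    case False
    have "L < \<beta> + 1"
    proof (rule ccontr)
      assume "\<not> L < \<beta> + 1"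
      then have L1: "\<beta> / L \<le> 1 - 1 / L" and L2: "\<beta> / L < 1"
        using L by (auto simp: field_simps)
      have c: "\<theta> \<bullet> thw \<ge> 0"
      proof (rule ccontr)
        assume neg: "\<not> \<theta> \<bullet> thw \<ge> 0"
        then have nz: "\<tau> \<noteq> 0" by auto
        with neg have "\<theta> \<bullet> \<tau> < 0" by (simp add: zero_le_divide_iff)
        then have "1 \<le> (norm (\<theta> - 1 *\<^sub>R \<tau>))\<^sup>2"
          unfolding unit_diff_scaleR[OF \<theta>] by (simp add: add_increasing2)
        then show False using err L2 by simp
      qed
      \<comment> \<open>The centre's inner product with \<open>\<theta>\<close> is at least the
        length of the tilt, so tilting cannot make it negative.\<close>
      have "(1 / sqrt L)\<^sup>2 \<le> (\<theta> \<bullet> thw)\<^sup>2"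
        using center L1 L by (simp add: power_divide)
      then have "1 / sqrt L \<le> \<theta> \<bullet> thw"
        using c by (rule power2_le_imp_le)
      moreover have "\<bar>\<theta> \<bullet> ((s / sqrt L) *\<^sub>R v)\<bar> \<le> 1 / sqrt L"
        using Cauchy_Schwarz_ineq2[of \<theta> "(s / sqrt L) *\<^sub>R v"] step_norm(1) \<theta> by simp
      ultimately have "0 \<le> \<theta> \<bullet> ta"
        unfolding inner_add_right by linarith
      then have "0 \<le> \<theta> \<bullet> act"
        by simp
      then show False using False by simp
    qed
    \<comment> \<open>As \<open>1 \<le> \<beta>\<close>, here \<open>L < 2 * \<beta>\<close>, and a
      loss never exceeds 2.\<close>
    then have "2 \<le> 4 * \<beta> / L"
      using L \<beta> by (simp add: field_simps)
    then show ?thesis using le1 by linarith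
  qed
qed

end

end

section \<open>One step of the subgaussian mixture\<close>

text \<open>The rounding is towards zero so that it cannot increase the subgaussian bound \<open>exp (y\<^sup>2 v / 2)\<close>.\<close>
definition quantum :: "nat \<Rightarrow> real \<Rightarrow> int" where
  "quantum n y = (if 0 \<le> y then \<lfloor>y * real (Suc n)\<rfloor> else - \<lfloor>- y * real (Suc n)\<rfloor>)"

definition quantize :: "nat \<Rightarrow> real \<Rightarrow> real" where
  "quantize n y = of_int (quantum n y) / real (Suc n)"

lemma quantum_measurable [measurable]: "quantum n \<in> borel \<rightarrow>\<^sub>M count_space UNIV"
  unfolding quantum_def[abs_def] by measurable

lemma abs_quantize_le: "\<bar>quantize n y\<bar> \<le> \<bar>y\<bar>"
proof -
  have "real_of_int \<bar>quantum n y\<bar> \<le> \<bar>y\<bar> * real (Suc n)"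
  proof (cases "0 \<le> y")
    case True
    then have "0 \<le> \<lfloor>y * real (Suc n)\<rfloor>"
      by simp
    then show ?thesis
      using True of_int_floor_le[of "y * real (Suc n)"] by (simp add: quantum_def del: of_nat_Suc)
  next
    case False
    then have "0 \<le> \<lfloor>- y * real (Suc n)\<rfloor>"
      by (simp add: mult_nonpos_nonneg)
    then show ?thesis
      using False of_int_floor_le[of "- y * real (Suc n)"] by (simp add: quantum_def del: of_nat_Suc)
  qed
  then show ?thesis
    by (simp add: quantize_def field_simps del: of_nat_Suc)
qed

lemma quantize_tendsto: "(\<lambda>n. quantize n y) \<longlonglongrightarrow> y"
proof (rule tendsto_sandwich)
  have "\<bar>of_int \<lfloor>u\<rfloor> - u\<bar> \<le> 1" "\<bar>- of_int \<lfloor>- u\<rfloor> - u\<bar> \<le> 1" for u :: real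
    by linarith+
  from this[of "y * real (Suc n)" for n]
  have *: "\<bar>real_of_int (quantum n y) - y * real (Suc n)\<bar> \<le> 1" for n
    by (auto simp: quantum_def simp del: of_nat_Suc)
  have "quantize n y - y = (real_of_int (quantum n y) - y * real (Suc n)) / real (Suc n)" for n
    by (simp add: quantize_def field_simps del: of_nat_Suc)
  then have **: "\<bar>quantize n y - y\<bar> \<le> 1 / real (Suc n)" for n
    using *[of n] by (simp add: divide_right_mono del: of_nat_Suc)
  show "\<forall>\<^sub>F n in sequentially. y - 1 / real (Suc n) \<le> quantize n y"
    using ** by (intro always_eventually allI) (smt (verit))
  show "\<forall>\<^sub>F n in sequentially. quantize n y \<le> y + 1 / real (Suc n)"
    using ** by (intro always_eventually allI) (smt (verit))
  show "(\<lambda>n. y - 1 / real (Suc n)) \<longlonglongrightarrow> y"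
    using tendsto_diff[OF tendsto_const LIMSEQ_inverse_real_of_nat, of y] by (simp add: inverse_eq_divide)
  show "(\<lambda>n. y + 1 / real (Suc n)) \<longlonglongrightarrow> y"
    using tendsto_add[OF tendsto_const LIMSEQ_inverse_real_of_nat, of y] by (simp add: inverse_eq_divide)
qed

context sigma_finite_subalgebra
begin

context
  fixes X v :: "'a \<Rightarrow> real"
  assumes X [measurable]: "X \<in> borel_measurable M"
    and v [measurable]: "v \<in> borel_measurable F" and v0: "\<And>\<omega>. \<omega> \<in> space M \<Longrightarrow> 0 \<le> v \<omega>"
    and subg: "\<And>\<mu>. AE \<omega> in M. nn_cond_exp M F (\<lambda>x. ennreal (exp (\<mu> * X x))) \<omega>
                  \<le> ennreal (exp (\<mu>\<^sup>2 * v \<omega> / 2))"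
begin

lemma subgaussian_const_param:
  fixes Z :: "'a \<Rightarrow> ennreal"
  assumes [measurable]: "Z \<in> borel_measurable F"
  shows "(\<integral>\<^sup>+\<omega>. Z \<omega> * ennreal (exp (\<mu> * X \<omega>)) \<partial>M) \<le> (\<integral>\<^sup>+\<omega>. Z \<omega> * ennreal (exp (\<mu>\<^sup>2 * v \<omega> / 2)) \<partial>M)"
proof -
  have "(\<integral>\<^sup>+\<omega>. Z \<omega> * ennreal (exp (\<mu> * X \<omega>)) \<partial>M)
      = (\<integral>\<^sup>+\<omega>. Z \<omega> * nn_cond_exp M F (\<lambda>x. ennreal (exp (\<mu> * X x))) \<omega> \<partial>M)"
    by (rule nn_cond_exp_intg[symmetric]) auto
  also have "\<dots> \<le> (\<integral>\<^sup>+\<omega>. Z \<omega> * ennreal (exp (\<mu>\<^sup>2 * v \<omega> / 2)) \<partial>M)"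
    by (rule nn_integral_mono_AE, rule eventually_mono[OF subg[of \<mu>]]) (rule mult_left_mono, simp_all)
  finally show ?thesis .
qed

text \<open>The exceptional null set in the hypothesis depends on \<open>\<mu>\<close>, so a random parameter is
  approximated by countably many values.\<close>
lemma subgaussian_quantized_param:
  fixes Z Y :: "'a \<Rightarrow> real"
  assumes Z [measurable]: "Z \<in> borel_measurable F" and Y [measurable]: "Y \<in> borel_measurable F"
  shows "(\<integral>\<^sup>+\<omega>. ennreal (Z \<omega>) * ennreal (exp (quantize n (Y \<omega>) * X \<omega>)) \<partial>M)
      \<le> (\<integral>\<^sup>+\<omega>. ennreal (Z \<omega>) * ennreal (exp ((quantize n (Y \<omega>))\<^sup>2 * v \<omega> / 2)) \<partial>M)"
proof -
  \<comment> \<open>The grid value coded as a natural number: the integral becomes a series over the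
    level sets of \<open>J\<close>, which lie in \<open>F\<close> and on which the parameter is
    constant.\<close>
  define J where "J \<omega> = to_nat (quantum n (Y \<omega>))" for \<omega>
  define y where "y i = of_int (from_nat i) / real (Suc n)" for i
  have J_meas [measurable]: "J \<in> F \<rightarrow>\<^sub>M count_space UNIV"
    unfolding J_def by measurable
  have [measurable]: "J \<in> M \<rightarrow>\<^sub>M count_space UNIV" "Z \<in> borel_measurable M" "v \<in> borel_measurable M"
    using J_meas Z v by (auto intro: measurable_from_subalg[OF subalg])
  have J_eq: "quantize n (Y \<omega>) = y (J \<omega>)" for \<omega>
    by (simp add: J_def y_def quantize_def)
  have split: "(\<integral>\<^sup>+\<omega>. ennreal (Z \<omega>) * f (J \<omega>) \<omega> \<partial>M)
      = (\<Sum>i. \<integral>\<^sup>+\<omega>. (ennreal (Z \<omega>) * indicator {\<omega>. J \<omega> = i} \<omega>) * f i \<omega> \<partial>M)"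
    if [measurable]: "\<And>i. f i \<in> borel_measurable M" for f :: "nat \<Rightarrow> 'a \<Rightarrow> ennreal"
  proof -
    have "(\<integral>\<^sup>+\<omega>. ennreal (Z \<omega>) * f (J \<omega>) \<omega> \<partial>M)
        = (\<integral>\<^sup>+\<omega>. (\<Sum>i. (ennreal (Z \<omega>) * indicator {\<omega>. J \<omega> = i} \<omega>) * f i \<omega>) \<partial>M)"
    proof (rule nn_integral_cong)
      fix \<omega>
      have "(\<lambda>i. if i = J \<omega> then ennreal (Z \<omega>) * f i \<omega> else 0) sums (ennreal (Z \<omega>) * f (J \<omega>) \<omega>)"
        by (rule sums_single)
      also have "(\<lambda>i. if i = J \<omega> then ennreal (Z \<omega>) * f i \<omega> else 0)
          = (\<lambda>i. (ennreal (Z \<omega>) * indicator {\<omega>. J \<omega> = i} \<omega>) * f i \<omega>)"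
        by (auto simp: indicator_def fun_eq_iff)
      finally show "ennreal (Z \<omega>) * f (J \<omega>) \<omega>
          = (\<Sum>i. (ennreal (Z \<omega>) * indicator {\<omega>. J \<omega> = i} \<omega>) * f i \<omega>)"
        by (rule sums_unique)
    qed
    also have "\<dots> = (\<Sum>i. \<integral>\<^sup>+\<omega>. (ennreal (Z \<omega>) * indicator {\<omega>. J \<omega> = i} \<omega>) * f i \<omega> \<partial>M)"
      by (rule nn_integral_suminf) measurable
    finally show ?thesis .
  qed
  show ?thesis
    unfolding J_eq
    by (subst (1 2) split, measurable, intro suminf_le subgaussian_const_param) measurable
qed

text \<open>The grid is refined by Fatou's lemma on the left. On the right no limit is taken, since
  rounding towards zero keeps every approximating bound below the final one.\<close>

lemma subgaussian_random_param:
  fixes Z Y :: "'a \<Rightarrow> real"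
  assumes Z [measurable]: "Z \<in> borel_measurable F" and Y [measurable]: "Y \<in> borel_measurable F"
    and Z0: "\<And>\<omega>. \<omega> \<in> space M \<Longrightarrow> 0 \<le> Z \<omega>"
  shows "(\<integral>\<^sup>+\<omega>. ennreal (Z \<omega> * exp (Y \<omega> * X \<omega>)) \<partial>M)
      \<le> (\<integral>\<^sup>+\<omega>. ennreal (Z \<omega> * exp ((Y \<omega>)\<^sup>2 * v \<omega> / 2)) \<partial>M)"
proof -
  have [measurable]: "Z \<in> borel_measurable M" "Y \<in> borel_measurable M" "v \<in> borel_measurable M"
    using Y Z v by (auto intro: measurable_from_subalg[OF subalg])
  have [measurable]: "quantize n \<in> borel_measurable borel" for n
    unfolding quantize_def[abs_def] by measurable
  have "(\<integral>\<^sup>+\<omega>. ennreal (Z \<omega> * exp (Y \<omega> * X \<omega>)) \<partial>M)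
      = (\<integral>\<^sup>+\<omega>. liminf (\<lambda>n. ennreal (Z \<omega> * exp (quantize n (Y \<omega>) * X \<omega>))) \<partial>M)"
  proof (rule nn_integral_cong)
    fix \<omega>
    have "(\<lambda>n. ennreal (Z \<omega> * exp (quantize n (Y \<omega>) * X \<omega>))) \<longlonglongrightarrow> ennreal (Z \<omega> * exp (Y \<omega> * X \<omega>))"
      by (intro tendsto_intros quantize_tendsto)
    then show "ennreal (Z \<omega> * exp (Y \<omega> * X \<omega>))
        = liminf (\<lambda>n. ennreal (Z \<omega> * exp (quantize n (Y \<omega>) * X \<omega>)))"
      by (simp add: lim_imp_Liminf)
  qed
  also have "\<dots> \<le> liminf (\<lambda>n. \<integral>\<^sup>+\<omega>. ennreal (Z \<omega> * exp (quantize n (Y \<omega>) * X \<omega>)) \<partial>M)"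
    by (rule nn_integral_liminf) measurable
  also have "\<dots> \<le> (\<integral>\<^sup>+\<omega>. ennreal (Z \<omega> * exp ((Y \<omega>)\<^sup>2 * v \<omega> / 2)) \<partial>M)"
  proof (rule Liminf_le)
    have "(\<integral>\<^sup>+\<omega>. ennreal (Z \<omega> * exp (quantize n (Y \<omega>) * X \<omega>)) \<partial>M)
        \<le> (\<integral>\<^sup>+\<omega>. ennreal (Z \<omega> * exp ((Y \<omega>)\<^sup>2 * v \<omega> / 2)) \<partial>M)" for n
    proof -
      have "(\<integral>\<^sup>+\<omega>. ennreal (Z \<omega> * exp (quantize n (Y \<omega>) * X \<omega>)) \<partial>M)
          = (\<integral>\<^sup>+\<omega>. ennreal (Z \<omega>) * ennreal (exp (quantize n (Y \<omega>) * X \<omega>)) \<partial>M)"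
        by (intro nn_integral_cong) (simp add: Z0 ennreal_mult)
      also have "\<dots> \<le> (\<integral>\<^sup>+\<omega>. ennreal (Z \<omega>) * ennreal (exp ((quantize n (Y \<omega>))\<^sup>2 * v \<omega> / 2)) \<partial>M)"
        by (rule subgaussian_quantized_param[OF Z Y])
      also have "\<dots> \<le> (\<integral>\<^sup>+\<omega>. ennreal (Z \<omega> * exp ((Y \<omega>)\<^sup>2 * v \<omega> / 2)) \<partial>M)"
      proof (rule nn_integral_mono)
        fix \<omega> assume \<omega>: "\<omega> \<in> space M"
        have "(quantize n (Y \<omega>))\<^sup>2 * v \<omega> \<le> (Y \<omega>)\<^sup>2 * v \<omega>"
          using abs_quantize_le[of n "Y \<omega>"] v0[OF \<omega>] by (intro mult_right_mono) (simp_all add: abs_le_square_iff)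
        then show "ennreal (Z \<omega>) * ennreal (exp ((quantize n (Y \<omega>))\<^sup>2 * v \<omega> / 2))
            \<le> ennreal (Z \<omega> * exp ((Y \<omega>)\<^sup>2 * v \<omega> / 2))"
          using Z0[OF \<omega>] by (simp add: ennreal_mult[symmetric] mult_left_mono)
      qed
      finally show ?thesis .
    qed
    then show "\<forall>\<^sub>F n in sequentially. (\<integral>\<^sup>+\<omega>. ennreal (Z \<omega> * exp (quantize n (Y \<omega>) * X \<omega>)) \<partial>M)
        \<le> (\<integral>\<^sup>+\<omega>. ennreal (Z \<omega> * exp ((Y \<omega>)\<^sup>2 * v \<omega> / 2)) \<partial>M)"
      by simp
  qed simp
  finally show ?thesis .
qed

end

end

text \<open>Completing the square. If \<open>x\<close> is Gaussian with mean
  \<open>matrix_inv V *v S\<close> and covariance \<open>matrix_inv V\<close>, then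
  \<open>b \<bullet> x\<close> has mean \<open>p\<close> and variance \<open>q\<close> as in
  \<open>matrix_inv_form_update\<close>; \<open>p + sqrt q * g\<close> is this variable.\<close>

lemma normal_mixture:
  fixes p q \<eta> :: real
  assumes "0 \<le> q"
  shows "(\<integral>\<^sup>+g. ennreal (std_normal_density g * exp ((p + sqrt q * g) * \<eta> - (p + sqrt q * g)\<^sup>2 / 2)) \<partial>lborel)
    = ennreal (exp ((2 * p * \<eta> + q * \<eta>\<^sup>2 - p\<^sup>2) / (2 * (1 + q))) / sqrt (1 + q))"
proof -
  define C where "C = exp ((2 * p * \<eta> + q * \<eta>\<^sup>2 - p\<^sup>2) / (2 * (1 + q))) / sqrt (1 + q)"
  define m where "m = sqrt q * (\<eta> - p) / (1 + q)"
  have q1: "1 + q > 0"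
    using assms by simp
  have C0: "C \<ge> 0"
    using q1 by (simp add: C_def)
  have eq: "std_normal_density g * exp ((p + sqrt q * g) * \<eta> - (p + sqrt q * g)\<^sup>2 / 2)
      = C * normal_density m (1 / sqrt (1 + q)) g" for g
  proof -
    have sq: "sqrt q * sqrt q = q"
      using assms by simp
    have "- g\<^sup>2 / 2 + ((p + sqrt q * g) * \<eta> - (p + sqrt q * g)\<^sup>2 / 2)
        = p * \<eta> - p\<^sup>2 / 2 + (sqrt q * (\<eta> - p)) * g - (1 + (sqrt q * sqrt q)) * g\<^sup>2 / 2"
      by (simp add: power2_eq_square field_simps)
    also have "\<dots> = (p * \<eta> - p\<^sup>2 / 2 + (sqrt q * (\<eta> - p))\<^sup>2 / (2 * (1 + q))) - (1 + q) * (g - m)\<^sup>2 / 2"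
      unfolding sq using q1 by (simp add: m_def divide_simps) (simp add: power2_eq_square algebra_simps)
    also have "p * \<eta> - p\<^sup>2 / 2 + (sqrt q * (\<eta> - p))\<^sup>2 / (2 * (1 + q)) = (2 * p * \<eta> + q * \<eta>\<^sup>2 - p\<^sup>2) / (2 * (1 + q))"
      using q1 assms by (simp add: power_mult_distrib divide_simps) (simp add: power2_eq_square algebra_simps)
    finally have "exp (- g\<^sup>2 / 2) * exp ((p + sqrt q * g) * \<eta> - (p + sqrt q * g)\<^sup>2 / 2)
        = exp ((2 * p * \<eta> + q * \<eta>\<^sup>2 - p\<^sup>2) / (2 * (1 + q))) * exp (- ((1 + q) * (g - m)\<^sup>2 / 2))"
      by (simp add: mult_exp_exp)
    moreover have "normal_density m (1 / sqrt (1 + q)) g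
        = sqrt (1 + q) * (1 / sqrt (2 * pi)) * exp (- ((1 + q) * (g - m)\<^sup>2 / 2))"
      using q1 by (simp add: normal_density_def power_divide real_sqrt_divide mult_ac)
    ultimately show ?thesis
      using q1 by (simp add: std_normal_density_def C_def)
  qed
  have "(\<integral>\<^sup>+g. ennreal (normal_density m (1 / sqrt (1 + q)) g) \<partial>lborel) = 1"
    using q1 by (subst nn_integral_eq_integral) auto
  then show ?thesis
    unfolding eq C_def[symmetric] using C0 by (simp add: ennreal_mult nn_integral_cmult)
qed

text \<open>After exchanging the integrals the mixing variable \<open>g\<close> is fixed, so the
  exponent is linear in the noise with an \<open>F\<close>-measurable coefficient. The subgaussian
  bound contributes at most \<open>exp (Y\<^sup>2 / 2)\<close> where \<open>w * v \<le> 1\<close>,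
  cancelling the quadratic term. That condition is asked only where \<open>Z\<close> is nonzero
  because \<open>Z\<close> will carry the indicator of the good event.\<close>

lemma (in sigma_finite_subalgebra) subgaussian_mixture_step:
  fixes X v Z p q w :: "'a \<Rightarrow> real"
  assumes X [measurable]: "X \<in> borel_measurable M"
    and meas: "v \<in> borel_measurable F" "Z \<in> borel_measurable F" "p \<in> borel_measurable F"
      "q \<in> borel_measurable F" "w \<in> borel_measurable F"
    and v0: "\<And>\<omega>. \<omega> \<in> space M \<Longrightarrow> 0 \<le> v \<omega>"
    and subg: "\<And>\<mu>. AE \<omega> in M. nn_cond_exp M F (\<lambda>x. ennreal (exp (\<mu> * X x))) \<omega>
                  \<le> ennreal (exp (\<mu>\<^sup>2 * v \<omega> / 2))"
    and Z0: "\<And>\<omega>. \<omega> \<in> space M \<Longrightarrow> 0 \<le> Z \<omega>" and q0: "\<And>\<omega>. \<omega> \<in> space M \<Longrightarrow> 0 \<le> q \<omega>"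
    and w0: "\<And>\<omega>. \<omega> \<in> space M \<Longrightarrow> 0 \<le> w \<omega>"
    and wv: "\<And>\<omega>. \<omega> \<in> space M \<Longrightarrow> Z \<omega> \<noteq> 0 \<Longrightarrow> w \<omega> * v \<omega> \<le> 1"
  defines "\<eta> \<equiv> \<lambda>\<omega>. sqrt (w \<omega>) * X \<omega>"
  shows "(\<integral>\<^sup>+\<omega>. ennreal (Z \<omega> * (exp ((2 * p \<omega> * \<eta> \<omega> + q \<omega> * (\<eta> \<omega>)\<^sup>2 - (p \<omega>)\<^sup>2) / (2 * (1 + q \<omega>)))
                              / sqrt (1 + q \<omega>))) \<partial>M)
      \<le> (\<integral>\<^sup>+\<omega>. ennreal (Z \<omega>) \<partial>M)"
proof -
  note [measurable] = meas
  have [measurable]: "v \<in> borel_measurable M" "Z \<in> borel_measurable M" "p \<in> borel_measurable M"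
      "q \<in> borel_measurable M" "w \<in> borel_measurable M"
    using meas by (auto intro: measurable_from_subalg[OF subalg])
  interpret pair_sigma_finite M lborel
    by unfold_locales
  define Y where "Y \<omega> g = p \<omega> + sqrt (q \<omega>) * g" for \<omega> g
  define f where "f \<omega> g = Z \<omega> * (std_normal_density g * exp (Y \<omega> g * \<eta> \<omega> - (Y \<omega> g)\<^sup>2 / 2))" for \<omega> g
  have "(\<integral>\<^sup>+\<omega>. ennreal (Z \<omega> * (exp ((2 * p \<omega> * \<eta> \<omega> + q \<omega> * (\<eta> \<omega>)\<^sup>2 - (p \<omega>)\<^sup>2) / (2 * (1 + q \<omega>)))
                              / sqrt (1 + q \<omega>))) \<partial>M)
      = (\<integral>\<^sup>+\<omega>. (\<integral>\<^sup>+g. ennreal (f \<omega> g) \<partial>lborel) \<partial>M)"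
  proof (rule nn_integral_cong)
    fix \<omega> assume \<omega>: "\<omega> \<in> space M"
    show "ennreal (Z \<omega> * (exp ((2 * p \<omega> * \<eta> \<omega> + q \<omega> * (\<eta> \<omega>)\<^sup>2 - (p \<omega>)\<^sup>2) / (2 * (1 + q \<omega>)))
                              / sqrt (1 + q \<omega>))) = (\<integral>\<^sup>+g. ennreal (f \<omega> g) \<partial>lborel)"
      unfolding f_def Y_def
      by (subst ennreal_mult[OF Z0[OF \<omega>]], simp add: q0[OF \<omega>])
         (subst normal_mixture[OF q0[OF \<omega>], symmetric],
          subst nn_integral_cmult[symmetric], measurable, simp add: ennreal_mult Z0[OF \<omega>])
  qed
  also have "\<dots> = (\<integral>\<^sup>+g. (\<integral>\<^sup>+\<omega>. ennreal (f \<omega> g) \<partial>M) \<partial>lborel)"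
    unfolding f_def Y_def \<eta>_def by (rule Fubini'[symmetric]) measurable
  also have "\<dots> \<le> (\<integral>\<^sup>+g. ennreal (std_normal_density g) * (\<integral>\<^sup>+\<omega>. ennreal (Z \<omega>) \<partial>M) \<partial>lborel)"
  proof (rule nn_integral_mono)
    fix g
    have "(\<integral>\<^sup>+\<omega>. ennreal (f \<omega> g) \<partial>M)
        = (\<integral>\<^sup>+\<omega>. ennreal ((Z \<omega> * (std_normal_density g * exp (- (Y \<omega> g)\<^sup>2 / 2))) * exp ((Y \<omega> g * sqrt (w \<omega>)) * X \<omega>)) \<partial>M)"
      by (intro nn_integral_cong) (simp add: f_def \<eta>_def mult_exp_exp mult_ac)
    also have "\<dots> \<le> (\<integral>\<^sup>+\<omega>. ennreal ((Z \<omega> * (std_normal_density g * exp (- (Y \<omega> g)\<^sup>2 / 2)))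
                                * exp ((Y \<omega> g * sqrt (w \<omega>))\<^sup>2 * v \<omega> / 2)) \<partial>M)"
      unfolding Y_def
      by (rule subgaussian_random_param[OF X meas(1) v0 subg]) (use Z0 in \<open>measurable, auto\<close>)
    also have "\<dots> \<le> (\<integral>\<^sup>+\<omega>. ennreal (std_normal_density g) * ennreal (Z \<omega>) \<partial>M)"
    proof (rule nn_integral_mono)
      fix \<omega> assume \<omega>: "\<omega> \<in> space M"
      show "ennreal ((Z \<omega> * (std_normal_density g * exp (- (Y \<omega> g)\<^sup>2 / 2)))
              * exp ((Y \<omega> g * sqrt (w \<omega>))\<^sup>2 * v \<omega> / 2)) \<le> ennreal (std_normal_density g) * ennreal (Z \<omega>)"
      proof (cases "Z \<omega> = 0")
        case False
        have "(Y \<omega> g)\<^sup>2 * (w \<omega> * v \<omega>) \<le> (Y \<omega> g)\<^sup>2 * 1"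
          using wv[OF \<omega> False] by (rule mult_left_mono) simp
        then have "exp (- (Y \<omega> g)\<^sup>2 / 2) * exp ((Y \<omega> g * sqrt (w \<omega>))\<^sup>2 * v \<omega> / 2) \<le> 1"
          using w0[OF \<omega>] by (simp add: mult_exp_exp power_mult_distrib mult_ac)
        then have "(Z \<omega> * std_normal_density g) * (exp (- (Y \<omega> g)\<^sup>2 / 2) * exp ((Y \<omega> g * sqrt (w \<omega>))\<^sup>2 * v \<omega> / 2))
            \<le> (Z \<omega> * std_normal_density g) * 1"
          using Z0[OF \<omega>] by (intro mult_left_mono) auto
        then show ?thesis
          using Z0[OF \<omega>] by (simp add: ennreal_mult[symmetric] mult_ac)
      qed simp
    qed
    also have "\<dots> = ennreal (std_normal_density g) * (\<integral>\<^sup>+\<omega>. ennreal (Z \<omega>) \<partial>M)"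
      by (rule nn_integral_cmult) measurable
    finally show "(\<integral>\<^sup>+\<omega>. ennreal (f \<omega> g) \<partial>M)
        \<le> ennreal (std_normal_density g) * (\<integral>\<^sup>+\<omega>. ennreal (Z \<omega>) \<partial>M)" .
  qed
  also have "\<dots> = (\<integral>\<^sup>+\<omega>. ennreal (Z \<omega>) \<partial>M)"
    by (subst nn_integral_multc) (auto simp: nn_integral_eq_integral)
  finally show ?thesis .
qed

section \<open>Paths of the algorithm\<close>

lemma sum_lessThan_add:
  fixes f :: "nat \<Rightarrow> 'a::comm_monoid_add"
  shows "sum f {..<a + b} = sum f {..<a} + (\<Sum>j<b. f (a + j))"
  by (induction b) (simp_all add: add.assoc)

lemma sum_lessThan_double:
  fixes f :: "nat \<Rightarrow> 'a::comm_monoid_add"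
  shows "sum f {..<2 * k} = (\<Sum>i\<in>{1..k}. f (2 * (i - 1)) + f (2 * (i - 1) + 1))"
  by (induction k) (simp_all add: add.assoc)

lemma det_mat: "det (mat c :: real^'n^'n) = c ^ CARD('n)"
  by (subst det_diagonal) (simp_all add: mat_def)

locale linucb_vn =
  fixes lam0 del0 :: real and E :: "real^'n^'n \<Rightarrow> nat \<Rightarrow> real^'n" and th0 \<theta> :: "real^'n"
  assumes E: "eig_selector E" and lam0: "2 \<le> lam0" and del0: "0 < del0" "del0 \<le> 1"
    and th0: "norm th0 = 1" and \<theta>: "norm \<theta> = 1" and card2: "2 \<le> CARD('n)"
begin

text \<open>All quantities are functions of the reward sequence \<open>r\<close>. A batch has \<open>m\<close> rounds, \<open>D\<close> is
  \<open>d - 1\<close>; \<open>Vb\<close>, \<open>bb\<close>, \<open>thw\<close> are the three components of the state. The index of the weights is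
  shifted against the paper: \<open>wb r t\<close> is \<open>w\<^sub>t\<^sub>+\<^sub>1\<close>, used in the rounds \<open>m t, ..., m (t + 1) - 1\<close>.
  \<open>wr\<close>, \<open>Vr\<close> and the weighted noise sum \<open>Nr\<close> are indexed by rounds; at multiples of \<open>m\<close> they
  agree with the batch quantities.\<close>
definition m :: nat where "m = 2 * (CARD('n) - 1)"
definition D :: real where "D = real CARD('n) - 1"

definition Vb where "Vb r t = fst (linucb_state lam0 del0 E th0 r t)"
definition bb where "bb r t = fst (snd (linucb_state lam0 del0 E th0 r t))"
definition thw where "thw r t = snd (snd (linucb_state lam0 del0 E th0 r t))"
definition wb where "wb r t = (if t = 0 then 1 else omega_w lam0 del0 (Vb r t))"
abbreviation act where "act \<equiv> linucb_action lam0 del0 E th0"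
abbreviation ba where "ba r t \<equiv> batch_act E (Vb r t) (thw r t)"
definition wr where "wr r k = wb r (k div m)"

definition Vr where "Vr r k = mat lam0 + (\<Sum>j<k. wr r j *\<^sub>R outer (act r j) (act r j))"
definition Nr where "Nr r k = (\<Sum>j<k. (wr r j * (r j - \<theta> \<bullet> act r j)) *\<^sub>R act r j)"

section \<open>Batch quantities and their round-by-round versions\<close>

lemma D_ge1: "1 \<le> D"
  using card2 by (simp add: D_def)

lemma real_m: "real m = 2 * D"
  using card2 by (simp add: m_def D_def of_nat_diff)

lemma m_pos: "0 < m"
  using card2 by (simp add: m_def)

lemma Vb_0: "Vb r 0 = mat lam0"
  by (simp add: Vb_def)

lemma bb_0: "bb r 0 = 0"
  by (simp add: bb_def)

lemma Vb_Suc: "Vb r (Suc t) = Vb r t + wb r t *\<^sub>R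
    (\<Sum>i\<in>{1..CARD('n) - 1}. outer (ba r t i 1) (ba r t i 1) + outer (ba r t i (-1)) (ba r t i (-1)))"
  by (simp add: Vb_def thw_def wb_def Let_def case_prod_unfold)

lemma bb_Suc: "bb r (Suc t) = bb r t + wb r t *\<^sub>R
    (\<Sum>i\<in>{1..CARD('n) - 1}. r (m * t + 2 * (i - 1)) *\<^sub>R ba r t i 1
        + r (m * t + 2 * (i - 1) + 1) *\<^sub>R ba r t i (-1))"
  by (simp add: Vb_def thw_def wb_def bb_def Let_def round_idx_def m_def case_prod_unfold)

lemma thw_Suc: "thw r (Suc t) = (1 / norm (matrix_inv (Vb r (Suc t)) *v bb r (Suc t))) *\<^sub>R
    (matrix_inv (Vb r (Suc t)) *v bb r (Suc t))"
  by (simp add: Vb_def thw_def wb_def bb_def Let_def case_prod_unfold)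

lemma act_eq: "act r k = ba r (k div m) (k mod m div 2 + 1) (if even (k mod m) then 1 else - 1)"
  by (simp add: linucb_action_def Vb_def thw_def Let_def m_def even_iff_mod_2_eq_zero case_prod_unfold)

lemma act_batch:
  assumes "i \<in> {1..CARD('n) - 1}"
  shows "act r (m * t + 2 * (i - 1)) = ba r t i 1" "act r (m * t + 2 * (i - 1) + 1) = ba r t i (-1)"
    "wr r (m * t + 2 * (i - 1)) = wb r t" "wr r (m * t + 2 * (i - 1) + 1) = wb r t"
proof -
  have lt: "2 * (i - 1) + 1 < m"
    using assms by (auto simp: m_def)
  then have "2 * (i - 1) < m"
    by simp
  with lt have *: "(m * t + 2 * (i - 1)) div m = t" "(m * t + 2 * (i - 1) + 1) div m = t"
      "(m * t + 2 * (i - 1)) mod m = 2 * (i - 1)" "(m * t + 2 * (i - 1) + 1) mod m = 2 * (i - 1) + 1"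
    using m_pos by (simp_all only: add.assoc div_mult_self4 mod_mult_self4 div_less mod_less)
  show "act r (m * t + 2 * (i - 1)) = ba r t i 1" "act r (m * t + 2 * (i - 1) + 1) = ba r t i (-1)"
    using assms unfolding act_eq * by simp_all
  show "wr r (m * t + 2 * (i - 1)) = wb r t" "wr r (m * t + 2 * (i - 1) + 1) = wb r t"
    unfolding wr_def * by simp_all
qed

lemma sum_batch:
  fixes f :: "nat \<Rightarrow> 'b::comm_monoid_add"
  shows "sum f {..<m * Suc t} = sum f {..<m * t}
    + (\<Sum>i\<in>{1..CARD('n) - 1}. f (m * t + 2 * (i - 1)) + f (m * t + 2 * (i - 1) + 1))"
proof -
  have "sum f {..<m * Suc t} = sum f {..<m * t} + (\<Sum>j<m. f (m * t + j))"
    using sum_lessThan_add[of f "m * t" m] by (simp add: add.commute)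
  also have "(\<Sum>j<m. f (m * t + j))
      = (\<Sum>i\<in>{1..CARD('n) - 1}. f (m * t + 2 * (i - 1)) + f (m * t + 2 * (i - 1) + 1))"
    unfolding m_def sum_lessThan_double by (simp add: add.assoc)
  finally show ?thesis .
qed

lemma Vb_eq_Vr: "Vb r t = Vr r (m * t)"
proof (induction t)
  case 0
  then show ?case by (simp add: Vb_0 Vr_def)
next
  case (Suc t)
  have "Vr r (m * Suc t) = Vr r (m * t) + (\<Sum>i\<in>{1..CARD('n) - 1}.
      wb r t *\<^sub>R outer (ba r t i 1) (ba r t i 1) + wb r t *\<^sub>R outer (ba r t i (-1)) (ba r t i (-1)))"
    unfolding Vr_def sum_batch by (simp only: act_batch cong: sum.cong) (simp add: add.assoc)
  then show ?case
    by (simp add: Vb_Suc Suc scaleR_sum_right scaleR_add_right)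
qed

text \<open>Splits rewards into mean and residual. As the noise is defined to be the residual, this
  holds for every sequence \<open>r\<close>.\<close>

lemma bb_eq_Nr: "bb r t = Nr r (m * t) + (Vb r t - mat lam0) *v \<theta>"
proof (induction t)
  case 0
  then show ?case by (simp add: Vb_0 bb_0 Nr_def)
next
  case (Suc t)
  have "Nr r (m * Suc t) = Nr r (m * t) + (\<Sum>i\<in>{1..CARD('n) - 1}.
      (wb r t * (r (m * t + 2 * (i - 1)) - \<theta> \<bullet> ba r t i 1)) *\<^sub>R ba r t i 1
    + (wb r t * (r (m * t + 2 * (i - 1) + 1) - \<theta> \<bullet> ba r t i (-1))) *\<^sub>R ba r t i (-1))"
    unfolding Nr_def sum_batch by (simp only: act_batch cong: sum.cong)
  then show ?case
    unfolding Vb_Suc bb_Suc Suc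
    by (simp add: matrix_vector_mult_add_rdistrib matrix_vector_mult_diff_rdistrib
        scaleR_matrix_mult_vec sum_matrix_mult_vec outer_mult_vec scaleR_sum_right
        sum.distrib sum_subtractf algebra_simps inner_commute)
qed

lemma omega_w_nonneg: "posdef (V :: real^'n^'n) \<Longrightarrow> 0 \<le> omega_w lam0 del0 V"
  using eigval_pos[OF E, of V "CARD('n)"] card2 D_ge1
  by (auto simp: omega_w_def beta_conf_def lam_max_eq_eigval[OF E posdef_symmetric] D_def intro!: divide_nonneg_nonneg mult_nonneg_nonneg)

lemma Vr_Suc: "Vr r (Suc k) = Vr r k + wr r k *\<^sub>R outer (act r k) (act r k)"
  by (simp add: Vr_def add.assoc)

lemma Nr_Suc: "Nr r (Suc k) = Nr r k + (wr r k * (r k - \<theta> \<bullet> act r k)) *\<^sub>R act r k"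
  by (simp add: Nr_def)

lemma outer_sqrt_scaleR: "0 \<le> c \<Longrightarrow> outer (sqrt c *\<^sub>R a) (sqrt c *\<^sub>R a) = c *\<^sub>R outer a (a :: real^'n)"
  by (simp add: outer_def vec_eq_iff mult_ac)

text \<open>Strong induction, because the sign of a weight depends on the matrix at the start of its
  batch.\<close>

lemma posdef_Vr: "posdef (Vr r k)"
proof (induction k rule: less_induct)
  case (less k)
  show ?case
  proof (cases k)
    case 0
    then show ?thesis using lam0 by (simp add: Vr_def posdef_mat)
  next
    case (Suc j)
    have "m * (j div m) < k"
      using Suc by (simp add: le_imp_less_Suc)
    then have "posdef (Vb r (j div m))"
      using less Vb_eq_Vr by metis
    then have "0 \<le> wr r j"
      by (simp add: wr_def wb_def omega_w_nonneg)
    moreover have "posdef (Vr r j)"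
      using less Suc by simp
    ultimately show ?thesis
      using posdef_add_outer[of "Vr r j" "sqrt (wr r j) *\<^sub>R act r j"]
      by (simp add: Suc Vr_Suc outer_sqrt_scaleR)
  qed
qed

lemma posdef_Vb: "posdef (Vb r t)"
  by (simp add: Vb_eq_Vr posdef_Vr)

lemma sym_Vb: "transpose (Vb r t) = Vb r t"
  by (rule posdef_symmetric[OF posdef_Vb])

lemma wb_nonneg: "0 \<le> wb r t"
  by (simp add: wb_def omega_w_nonneg posdef_Vb)

lemma wr_nonneg: "0 \<le> wr r k"
  by (simp add: wr_def wb_nonneg)

lemma Vr_Suc_outer: "Vr r (Suc k) = Vr r k + outer (sqrt (wr r k) *\<^sub>R act r k) (sqrt (wr r k) *\<^sub>R act r k)"
  by (simp add: Vr_Suc outer_sqrt_scaleR wr_nonneg)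

lemma Vr_form_ge: "lam0 * (x \<bullet> x) \<le> x \<bullet> (Vr r k *v x)"
proof -
  have "x \<bullet> (Vr r k *v x) = lam0 * (x \<bullet> x) + (\<Sum>j<k. wr r j * (act r j \<bullet> x)\<^sup>2)"
    by (simp add: Vr_def matrix_vector_mult_add_rdistrib sum_matrix_mult_vec scaleR_matrix_mult_vec
        outer_mult_vec mat_mult_vec inner_add_right inner_sum_right inner_commute power2_eq_square mult.assoc)
  moreover have "0 \<le> (\<Sum>j<k. wr r j * (act r j \<bullet> x)\<^sup>2)"
    by (intro sum_nonneg mult_nonneg_nonneg wr_nonneg) simp
  ultimately show ?thesis by simp
qed

lemma det_mat_lam0_pos: "0 < det (mat lam0 :: real^'n^'n)"
  using lam0 by (simp add: det_mat)

lemma det_Vr_ge: "det (mat lam0 :: real^'n^'n) \<le> det (Vr r k)"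
proof (induction k)
  case 0
  then show ?case by (simp add: Vr_def)
next
  case (Suc k)
  let ?b = "sqrt (wr r k) *\<^sub>R act r k"
  have "0 \<le> ?b \<bullet> (matrix_inv (Vr r k) *v ?b)"
    by (rule matrix_inv_form_nonneg[OF posdef_Vr])
  then have "1 * det (Vr r k) \<le> det (Vr r (Suc k))"
    unfolding Vr_Suc_outer det_add_outer[OF posdef_Vr]
    by (intro mult_right_mono less_imp_le[OF posdef_det_pos[OF E posdef_Vr]]) linarith
  with Suc show ?case by simp
qed

section \<open>Confidence radius, estimation error and errors of the actions\<close>

definition rho where "rho r t = 2 * ln (1 / del0) + ln (det (Vb r t) / det (mat lam0 :: real^'n^'n))"
definition beta where "beta r t = beta_conf lam0 del0 (Vb r t)"
definition lmin where "lmin r t = eigval E (Vb r t) 1"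
definition lmax where "lmax r t = lam_max (Vb r t)"
definition est where "est r t = matrix_inv (Vb r t) *v bb r t"

text \<open>The threshold \<open>rho\<close> is twice the logarithm of
  \<open>sqrt (det V / det V\<^sub>0) / del0\<close>, so failure means that the mixture process
  \<open>Zr\<close> exceeds \<open>1 / del0\<close>.\<close>

definition good where
  "good r t \<longleftrightarrow> Nr r (m * t) \<bullet> (matrix_inv (Vb r t) *v Nr r (m * t)) \<le> rho r t"

lemma rho_nonneg: "0 \<le> rho r t"
  using del0 det_Vr_ge[of r "m * t"] det_mat_lam0_pos by (simp add: rho_def Vb_eq_Vr)

lemma beta_eq: "beta r t = (sqrt (rho r t) + sqrt lam0)\<^sup>2"
  by (simp add: beta_def beta_conf_def rho_def)

lemma beta_ge: "lam0 \<le> beta r t"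
proof -
  have "(sqrt lam0)\<^sup>2 \<le> (sqrt (rho r t) + sqrt lam0)\<^sup>2"
    using lam0 rho_nonneg by (intro power_mono) auto
  then show ?thesis using lam0 by (simp add: beta_eq)
qed

lemma lmin_ge: "lam0 \<le> lmin r t"
  unfolding lmin_def by (rule eigval_1_greatest[OF E sym_Vb]) (simp add: Vb_eq_Vr Vr_form_ge)

lemma lmin_le_lmax: "lmin r t \<le> lmax r t"
  unfolding lmin_def lmax_def lam_max_eq_eigval[OF E sym_Vb]
  by (rule eig_selector_mono[OF E sym_Vb]) (simp_all add: Suc_leI)

text \<open>For \<open>u = matrix_inv V *v \<theta>\<close> one has \<open>lam0 * (norm u)\<^sup>2
  \<le> \<theta> \<bullet> u \<le> norm u\<close>, hence
  \<open>norm u \<le> 1 / lam0\<close>.\<close>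

lemma inv_form_theta_le: "\<theta> \<bullet> (matrix_inv (Vb r t) *v \<theta>) \<le> 1 / lam0"
proof -
  let ?u = "matrix_inv (Vb r t) *v \<theta>"
  have "lam0 * (norm ?u)\<^sup>2 \<le> ?u \<bullet> (Vb r t *v ?u)"
    using Vr_form_ge[of ?u r "m * t"] by (simp add: Vb_eq_Vr power2_norm_eq_inner)
  also have "\<dots> = \<theta> \<bullet> ?u"
    by (simp add: mult_matrix_inv_vec posdef_Vb inner_commute)
  finally have 1: "lam0 * (norm ?u)\<^sup>2 \<le> \<theta> \<bullet> ?u" .
  have 2: "\<theta> \<bullet> ?u \<le> norm ?u"
    using norm_cauchy_schwarz[of \<theta> ?u] \<theta> by simp
  have "norm ?u \<le> 1 / lam0"
  proof (cases "norm ?u = 0")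
    case False
    have "norm ?u * (lam0 * norm ?u) \<le> norm ?u * 1"
      using 1 2 by (simp add: power2_eq_square mult_ac)
    then have "lam0 * norm ?u \<le> 1"
      using False by simp
    then show ?thesis using lam0 by (simp add: field_simps)
  qed (use lam0 in simp)
  with 2 show ?thesis by simp
qed

text \<open>The error is a noise part minus the bias of the regularisation. In the norm of
  \<open>V\<close> they are at most \<open>sqrt rho\<close> and \<open>sqrt lam0\<close>, the two
  summands of \<open>sqrt beta\<close>.\<close>

lemma good_close:
  assumes "good r t"
  shows "lmin r t * (norm (est r t - \<theta>))\<^sup>2 \<le> beta r t"
proof -
  let ?V = "Vb r t" and ?N = "Nr r (m * t)"
  let ?x = "matrix_inv ?V *v ?N" and ?y = "lam0 *\<^sub>R (matrix_inv ?V *v \<theta>)"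
  have "bb r t = ?N + ?V *v \<theta> - lam0 *\<^sub>R \<theta>"
    by (simp add: bb_eq_Nr matrix_vector_mult_diff_rdistrib mat_mult_vec)
  then have est: "est r t - \<theta> = ?x - ?y"
    by (simp add: est_def matrix_vector_right_distrib matrix_vector_mult_diff_distrib
        matrix_vector_mult_scaleR matrix_inv_mult_vec posdef_Vb)
  have x: "?x \<bullet> (?V *v ?x) \<le> (sqrt (rho r t))\<^sup>2"
    using assms rho_nonneg by (simp add: good_def mult_matrix_inv_vec posdef_Vb inner_commute)
  have "?y \<bullet> (?V *v ?y) = lam0\<^sup>2 * (\<theta> \<bullet> (matrix_inv ?V *v \<theta>))"
    by (simp add: matrix_vector_mult_scaleR mult_matrix_inv_vec posdef_Vb inner_commute power2_eq_square)
  also have "\<dots> \<le> lam0\<^sup>2 * (1 / lam0)"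
    by (intro mult_left_mono inv_form_theta_le) simp
  also have "\<dots> = (sqrt lam0)\<^sup>2"
    using lam0 by (simp add: power2_eq_square)
  finally have y: "?y \<bullet> (?V *v ?y) \<le> (sqrt lam0)\<^sup>2" .
  have "lmin r t * (norm (est r t - \<theta>))\<^sup>2 \<le> (est r t - \<theta>) \<bullet> (?V *v (est r t - \<theta>))"
    unfolding lmin_def power2_norm_eq_inner by (rule eigval_1_form_le[OF E sym_Vb])
  also have "\<dots> \<le> beta r t"
    unfolding est beta_eq
    by (rule posdef_form_triangle[OF posdef_Vb x y]) (use lam0 rho_nonneg in auto)
  finally show ?thesis .
qed

text \<open>For \<open>t = 0\<close> the direction \<open>th0\<close> is not derived from an estimate, but it still is a normalised vector.\<close>
lemma thw_normalized: "\<exists>\<tau>. thw r t = (1 / norm \<tau>) *\<^sub>R \<tau> \<and> (0 < t \<longrightarrow> \<tau> = est r t)"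
proof (cases t)
  case 0
  then show ?thesis using th0 by (intro exI[of _ th0]) (simp add: thw_def)
next
  case (Suc n)
  then show ?thesis by (simp only: thw_Suc est_def) blast
qed

lemma ba_eq: "ba r t i s = (1 / norm (thw r t + (s / sqrt (lmin r t)) *\<^sub>R E (Vb r t) i))
    *\<^sub>R (thw r t + (s / sqrt (lmin r t)) *\<^sub>R E (Vb r t) i)"
  by (simp add: batch_act_def Let_def lmin_def)

lemma norm_eigvec: "i \<in> {1..CARD('n)} \<Longrightarrow> norm (E (Vb r t) i) = 1"
  using eig_selector_orthonormal[OF E sym_Vb, of i i] by (simp add: norm_eq_1)

lemma ba_nonzero:
  assumes "i \<in> {1..CARD('n)}" "\<bar>s\<bar> = 1"
  shows "thw r t + (s / sqrt (lmin r t)) *\<^sub>R E (Vb r t) i \<noteq> 0"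
    and "(norm (thw r t + (s / sqrt (lmin r t)) *\<^sub>R E (Vb r t) i))\<^sup>2 \<le> 3"
proof -
  have L: "2 \<le> lmin r t"
    using lmin_ge[of r t] lam0 by linarith
  obtain \<tau> where \<tau>: "thw r t = (1 / norm \<tau>) *\<^sub>R \<tau>"
    using thw_normalized by blast
  show "thw r t + (s / sqrt (lmin r t)) *\<^sub>R E (Vb r t) i \<noteq> 0"
    unfolding \<tau> by (rule tilted_nonzero[OF norm_eigvec[OF assms(1)] assms(2) L])
  show "(norm (thw r t + (s / sqrt (lmin r t)) *\<^sub>R E (Vb r t) i))\<^sup>2 \<le> 3"
    unfolding \<tau> by (rule tilted_norm[OF norm_eigvec[OF assms(1)] assms(2) L])
qed

lemma norm_ba:
  assumes "i \<in> {1..CARD('n)}" "\<bar>s\<bar> = 1"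
  shows "norm (ba r t i s) = 1"
  using ba_nonzero(1)[OF assms] by (simp add: ba_eq)

lemma act_index: "k mod m div 2 + 1 \<in> {1..CARD('n) - 1}"
proof -
  have "k mod m < 2 * (CARD('n) - 1)"
    using m_pos by (simp add: m_def)
  then show ?thesis by auto
qed

lemma norm_act: "norm (act r k) = 1"
  unfolding act_eq by (rule norm_ba) (use act_index[of k] in auto)

lemma good_act:
  assumes "good r (k div m)" "0 < k div m"
  shows "1 - (\<theta> \<bullet> act r k)\<^sup>2 \<le> 4 * beta r (k div m) / lmin r (k div m)"
    and "1 - \<theta> \<bullet> act r k \<le> 4 * beta r (k div m) / lmin r (k div m)"
proof -
  let ?t = "k div m"
  have L: "2 \<le> lmin r ?t"
    using lmin_ge[of r ?t] lam0 by linarith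
  have \<tau>: "thw r ?t = (1 / norm (est r ?t)) *\<^sub>R est r ?t"
    using thw_normalized assms(2) by blast
  have i: "k mod m div 2 + 1 \<in> {1..CARD('n)}"
    using act_index[of k] by auto
  have \<beta>: "1 \<le> beta r ?t"
    using beta_ge[of r ?t] lam0 by linarith
  have s: "\<bar>if even (k mod m) then 1 else - 1 :: real\<bar> = 1"
    by simp
  show "1 - (\<theta> \<bullet> act r k)\<^sup>2 \<le> 4 * beta r ?t / lmin r ?t"
    unfolding act_eq ba_eq unfolding \<tau>
    by (rule tilted_angle[OF norm_eigvec[OF i] s L \<theta> \<beta> good_close[OF assms(1)]])
  show "1 - \<theta> \<bullet> act r k \<le> 4 * beta r ?t / lmin r ?t"
    unfolding act_eq ba_eq unfolding \<tau>
    by (rule tilted_regret[OF norm_eigvec[OF i] s L \<theta> \<beta> good_close[OF assms(1)]])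
qed

section \<open>Growth of the extreme eigenvalues and the invariant\<close>

lemma Vb_Suc_form: "x \<bullet> (Vb r (Suc t) *v x) = x \<bullet> (Vb r t *v x)
    + wb r t * (\<Sum>i\<in>{1..CARD('n) - 1}. (ba r t i 1 \<bullet> x)\<^sup>2 + (ba r t i (-1) \<bullet> x)\<^sup>2)"
  by (simp add: Vb_Suc matrix_vector_mult_add_rdistrib sum_matrix_mult_vec scaleR_matrix_mult_vec
      outer_mult_vec inner_add_right inner_sum_right inner_commute power2_eq_square)

text \<open>Adding the two signs cancels the cross terms with the centre; the normalisation costs
  the factor 3.\<close>

lemma ba_sq_ge:
  assumes "i \<in> {1..CARD('n)}"
  shows "(2 / (3 * lmin r t)) * (E (Vb r t) i \<bullet> x)\<^sup>2 \<le> (ba r t i 1 \<bullet> x)\<^sup>2 + (ba r t i (-1) \<bullet> x)\<^sup>2"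
proof -
  let ?ta = "\<lambda>s. thw r t + (s / sqrt (lmin r t)) *\<^sub>R E (Vb r t) i"
  have L: "lmin r t > 0"
    using lmin_ge[of r t] lam0 by linarith
  have ge: "(?ta s \<bullet> x)\<^sup>2 / 3 \<le> (ba r t i s \<bullet> x)\<^sup>2" if "\<bar>s\<bar> = 1" for s
  proof -
    have "0 < (norm (?ta s))\<^sup>2" "(norm (?ta s))\<^sup>2 \<le> 3"
      using ba_nonzero[OF assms that] by simp_all
    then have "(?ta s \<bullet> x)\<^sup>2 / 3 \<le> (?ta s \<bullet> x)\<^sup>2 / (norm (?ta s))\<^sup>2"
      by (intro divide_left_mono) auto
    also have "\<dots> = (ba r t i s \<bullet> x)\<^sup>2"
      unfolding ba_eq by (simp add: power_divide)
    finally show ?thesis .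
  qed
  have "(?ta 1 \<bullet> x)\<^sup>2 + (?ta (-1) \<bullet> x)\<^sup>2
      = 2 * (thw r t \<bullet> x)\<^sup>2 + 2 * (1 / lmin r t) * (E (Vb r t) i \<bullet> x)\<^sup>2"
    using L by (simp add: inner_add_left power2_eq_square algebra_simps add_divide_distrib)
  moreover have "0 \<le> (thw r t \<bullet> x)\<^sup>2"
    by simp
  ultimately have "2 * (1 / lmin r t) * (E (Vb r t) i \<bullet> x)\<^sup>2 \<le> (?ta 1 \<bullet> x)\<^sup>2 + (?ta (-1) \<bullet> x)\<^sup>2"
    by linarith
  with ge[of 1] ge[of "-1"] have "2 * (1 / lmin r t) * (E (Vb r t) i \<bullet> x)\<^sup>2 / 3
      \<le> (ba r t i 1 \<bullet> x)\<^sup>2 + (ba r t i (-1) \<bullet> x)\<^sup>2"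
    by simp
  then show ?thesis by simp
qed

text \<open>In the old eigenbasis the first \<open>d - 1\<close> directions gain
  \<open>2w / (3 lmin)\<close> each. The top direction is promised no gain but already has the value
  \<open>lmax\<close>.\<close>

lemma lmin_Suc_ge: "min (lmin r t + 2 * wb r t / (3 * lmin r t)) (lmax r t) \<le> lmin r (Suc t)"
  unfolding lmin_def[of r "Suc t"]
proof (rule eigval_1_greatest[OF E sym_Vb])
  fix x :: "real^'n"
  let ?d = "CARD('n)"
  let ?e = "\<lambda>i. (E (Vb r t) i \<bullet> x)\<^sup>2"
  let ?g = "2 * wb r t / (3 * lmin r t)"
  let ?c = "min (lmin r t + ?g) (lmax r t)"
  have L: "lmin r t > 0"
    using lmin_ge[of r t] lam0 by linarith
  have split: "(\<Sum>i\<in>{1..?d}. f i) = (\<Sum>i\<in>{1..?d - 1}. f i) + f ?d" for f :: "nat \<Rightarrow> real"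
    using card2 by (cases ?d) simp_all
  have eigs: "lmin r t \<le> eigval E (Vb r t) i" if "i \<in> {1..?d}" for i
    unfolding lmin_def using that by (intro eig_selector_mono[OF E sym_Vb]) auto
  have "?c * (x \<bullet> x) = (\<Sum>i\<in>{1..?d - 1}. ?c * ?e i) + ?c * ?e ?d"
    unfolding eig_selector_inner[OF E sym_Vb[of r t], of x x] sum_distrib_left split
    by (simp add: power2_eq_square sum_distrib_left distrib_left)
  also have "\<dots> \<le> (\<Sum>i\<in>{1..?d - 1}. (eigval E (Vb r t) i + ?g) * ?e i) + eigval E (Vb r t) ?d * ?e ?d"
  proof (intro add_mono sum_mono mult_right_mono)
    show "?c \<le> eigval E (Vb r t) i + ?g" if "i \<in> {1..?d - 1}" for i
    proof -
      have "lmin r t \<le> eigval E (Vb r t) i"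
        using that by (intro eigs) auto
      then show ?thesis by linarith
    qed
    show "?c \<le> eigval E (Vb r t) ?d"
      by (simp add: lmax_def lam_max_eq_eigval[OF E sym_Vb])
  qed auto
  also have "\<dots> = x \<bullet> (Vb r t *v x) + wb r t * (\<Sum>i\<in>{1..?d - 1}. (2 / (3 * lmin r t)) * ?e i)"
    unfolding eig_selector_form[OF E sym_Vb[of r t]] split sum_distrib_left
    by (simp add: distrib_right sum.distrib) (simp add: mult_ac)
  also have "\<dots> \<le> x \<bullet> (Vb r (Suc t) *v x)"
    unfolding Vb_Suc_form
    by (intro add_left_mono mult_left_mono sum_mono ba_sq_ge wb_nonneg) auto
  finally show "?c * (x \<bullet> x) \<le> x \<bullet> (Vb r (Suc t) *v x)" .
qed

lemma lmax_Suc_le: "lmax r (Suc t) \<le> lmax r t + 2 * D * wb r t"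
  unfolding lmax_def[of r "Suc t"] lam_max_le_iff[OF E sym_Vb]
proof
  fix x :: "real^'n"
  have ba: "(ba r t i s \<bullet> x)\<^sup>2 \<le> x \<bullet> x" if "i \<in> {1..CARD('n)}" "\<bar>s\<bar> = 1" for i s
    using Cauchy_Schwarz_ineq[of "ba r t i s" x] norm_ba[OF that] by (simp add: norm_eq_1)
  have "(\<Sum>i\<in>{1..CARD('n) - 1}. (ba r t i 1 \<bullet> x)\<^sup>2 + (ba r t i (-1) \<bullet> x)\<^sup>2)
      \<le> (\<Sum>i\<in>{1..CARD('n) - 1}. x \<bullet> x + x \<bullet> x)"
    by (intro sum_mono add_mono ba) auto
  also have "\<dots> = 2 * D * (x \<bullet> x)"
    using card2 by (simp add: D_def of_nat_diff)
  finally have "wb r t * (\<Sum>i\<in>{1..CARD('n) - 1}. (ba r t i 1 \<bullet> x)\<^sup>2 + (ba r t i (-1) \<bullet> x)\<^sup>2)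
      \<le> wb r t * (2 * D * (x \<bullet> x))"
    by (intro mult_left_mono wb_nonneg)
  with form_le_lam_max[OF E sym_Vb[of r t], of x]
  show "x \<bullet> (Vb r (Suc t) *v x) \<le> (lmax r t + 2 * D * wb r t) * (x \<bullet> x)"
    by (simp add: Vb_Suc_form lmax_def algebra_simps)
qed

lemma lmax_0: "lmax r 0 = lam0"
proof (rule antisym)
  show "lmax r 0 \<le> lam0"
    unfolding lmax_def lam_max_le_iff[OF E sym_Vb] by (simp add: Vb_0 mat_mult_vec)
  show "lam0 \<le> lmax r 0"
    using lmin_ge lmin_le_lmax order_trans by blast
qed

lemma lmax_ge: "lam0 \<le> lmax r t"
  using lmin_ge lmin_le_lmax order_trans by blast

lemma wb_eq: "0 < t \<Longrightarrow> wb r t = sqrt (lmax r t) / (12 * sqrt D * beta r t)"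
  by (simp add: wb_def omega_w_def lmax_def beta_def D_def)

lemma wb_le:
  assumes "0 < t"
  shows "wb r t \<le> lmax r t / 24"
proof -
  have b: "2 \<le> beta r t" and l: "1 \<le> lmax r t"
    using beta_ge[of r t] lmax_ge[of r t] lam0 by linarith+
  have "12 * 1 * 2 \<le> 12 * sqrt D * beta r t"
    using b D_ge1 by (intro mult_mono) auto
  then have "wb r t \<le> sqrt (lmax r t) / 24"
    unfolding wb_eq[OF assms] using l b D_ge1 by (intro divide_left_mono mult_pos_pos) auto
  also have "sqrt (lmax r t) \<le> lmax r t"
    using l by (simp add: real_sqrt_le_iff' self_le_power sqrt_le_D real_le_lsqrt)
  finally show ?thesis by simp
qed

text \<open>If the minimum in \<open>lmin_Suc_ge\<close> is attained by its first entry, then the cross term in the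
  square of \<open>lmin + 2w / (3 lmin)\<close> is exactly what the growth of \<open>lmax\<close> by \<open>2(d - 1)w\<close> requires.\<close>
lemma lmin_sq_ge: "2 / (3 * D) * lmax r (Suc t) \<le> (lmin r (Suc t))\<^sup>2"
proof (induction t)
  case 0
  \<comment> \<open>The first batch has weight 1 instead of \<open>omega_w\<close>;
    \<open>lam0 \<ge> 2\<close> absorbs it.\<close>
  have "2 / (3 * D) * lmax r (Suc 0) \<le> 2 / (3 * D) * (lam0 + 2 * D)"
    using lmax_Suc_le[of r 0] D_ge1 by (intro mult_left_mono) (auto simp: lmax_0 wb_def)
  also have "\<dots> = 2 / 3 * (lam0 / D) + 4 / 3"
    using D_ge1 by (simp add: field_simps)
  also have "lam0 / D \<le> lam0 / 1"
    using lam0 D_ge1 by (intro divide_left_mono) auto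
  also have "2 / 3 * (lam0 / 1) + 4 / 3 \<le> 2 * lam0"
    using lam0 by simp
  also have "\<dots> \<le> lam0 * lam0"
    using lam0 by (intro mult_right_mono) auto
  also have "\<dots> \<le> (lmin r (Suc 0))\<^sup>2"
    using lmin_ge[of r "Suc 0"] lam0 by (simp add: power2_eq_square mult_mono)
  finally show ?case by simp
next
  case (Suc t)
  let ?t = "Suc t"
  let ?L = "lmin r ?t" and ?l = "lmax r ?t" and ?w = "wb r ?t"
  have L: "?L \<ge> 2" and l: "?l \<ge> 2"
    using lmin_ge[of r ?t] lmax_ge[of r ?t] lam0 by linarith+
  have "2 / (3 * D) * lmax r (Suc ?t) \<le> 2 / (3 * D) * (?l + 2 * D * ?w)"
    using lmax_Suc_le[of r ?t] D_ge1 by (intro mult_left_mono) auto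
  also have "\<dots> = 2 / (3 * D) * ?l + 4 / 3 * ?w"
    using D_ge1 by (simp add: field_simps)
  finally have up: "2 / (3 * D) * lmax r (Suc ?t) \<le> 2 / (3 * D) * ?l + 4 / 3 * ?w" .
  let ?g = "2 * ?w / (3 * ?L)"
  have g: "0 \<le> ?g"
    using wb_nonneg[of r ?t] L by simp
  show ?case
  proof (cases "?L + ?g \<le> ?l")
    case True
    then have "?L + ?g \<le> lmin r (Suc ?t)"
      using lmin_Suc_ge[of r ?t] by simp
    then have "(?L + ?g)\<^sup>2 \<le> (lmin r (Suc ?t))\<^sup>2"
      using L g by (intro power_mono) auto
    moreover have "(?L + ?g)\<^sup>2 = ?L\<^sup>2 + 4 / 3 * ?w + ?g\<^sup>2"
      using L by (simp add: power2_sum)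
    moreover have "0 \<le> ?g\<^sup>2"
      by simp
    ultimately show ?thesis
      using up Suc by linarith
  next
    \<comment> \<open>Now the new \<open>lmin\<close> has reached the old \<open>lmax\<close>, whose
      square is at least \<open>2 * lmax\<close>; this dominates the new \<open>lmax\<close> because
      weights are at most \<open>lmax / 24\<close>.\<close>
    case False
    then have "?l \<le> lmin r (Suc ?t)"
      using lmin_Suc_ge[of r ?t] by simp
    then have "?l\<^sup>2 \<le> (lmin r (Suc ?t))\<^sup>2"
      using l by (intro power_mono) auto
    moreover have "?l * 2 \<le> ?l\<^sup>2"
      unfolding power2_eq_square using l by (intro mult_left_mono) auto
    moreover have "?w \<le> ?l / 24"
      by (rule wb_le) simp
    moreover have "2 / (3 * D) * ?l \<le> 2 / 3 * ?l"
      using D_ge1 l by (intro mult_right_mono) (auto simp: field_simps)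
    ultimately show ?thesis
      using up l by linarith
  qed
qed

lemma lmin_ge_sqrt_lmax:
  assumes "0 < t"
  shows "sqrt (2 / 3) * sqrt (lmax r t) \<le> sqrt D * lmin r t"
proof (rule power2_le_imp_le)
  obtain n where t: "t = Suc n"
    using assms by (cases t) auto
  have "D * (2 / (3 * D) * lmax r t) \<le> D * (lmin r t)\<^sup>2"
    unfolding t using D_ge1 by (intro mult_left_mono lmin_sq_ge) auto
  then show "(sqrt (2 / 3) * sqrt (lmax r t))\<^sup>2 \<le> (sqrt D * lmin r t)\<^sup>2"
    using D_ge1 lmax_ge[of r t] lam0 by (simp add: power_mult_distrib)
  show "0 \<le> sqrt D * lmin r t"
    using D_ge1 lmin_ge[of r t] lam0 by (intro mult_nonneg_nonneg) auto
qed

text \<open>The 12 in \<open>omega_w\<close> against the 4 in \<open>good_act\<close> leaves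
  \<open>sqrt lmax / (3 * sqrt D * lmin)\<close>, where the invariant gives at most
  \<open>sqrt (3 / 2) / 3\<close>. In the first batch the weight is 1 and the variance bound is at
  most 1.\<close>

lemma weight_le:
  assumes "0 < k div m \<Longrightarrow> good r (k div m)"
  shows "wr r k * (1 - (\<theta> \<bullet> act r k)\<^sup>2) \<le> 1"
proof (cases "0 < k div m")
  case False
  then show ?thesis by (simp add: wr_def wb_def)
next
  case True
  let ?t = "k div m"
  have pos: "0 < lmin r ?t" "0 < beta r ?t" "0 < sqrt D" "0 \<le> sqrt (lmax r ?t)"
    using lmin_ge[of r ?t] beta_ge[of r ?t] lmax_ge[of r ?t] lam0 D_ge1 by auto
  have "wr r k * (1 - (\<theta> \<bullet> act r k)\<^sup>2) \<le> wb r ?t * (4 * beta r ?t / lmin r ?t)"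
    unfolding wr_def by (intro mult_left_mono good_act assms True wb_nonneg)
  also have "\<dots> = sqrt (lmax r ?t) / (3 * (sqrt D * lmin r ?t))"
    using pos unfolding wb_eq[OF True] by (simp add: field_simps)
  also have "\<dots> \<le> 1"
  proof -
    have "1 / 3 \<le> sqrt (2 / 3)"
      by (rule real_le_rsqrt) (simp add: power2_eq_square)
    then have "1 / 3 * sqrt (lmax r ?t) \<le> sqrt (2 / 3) * sqrt (lmax r ?t)"
      using pos by (intro mult_right_mono) auto
    then have "sqrt (lmax r ?t) \<le> 3 * (sqrt D * lmin r ?t)"
      using lmin_ge_sqrt_lmax[OF True, of r] by simp
    then show ?thesis
      using pos by (simp add: field_simps)
  qed
  finally show ?thesis .
qed

section \<open>Growth of the trace and regret along a good path\<close>

definition tr where "tr r t = trace (Vb r t)"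

lemma tr_0: "tr r 0 = (D + 1) * lam0"
  by (simp add: tr_def Vb_0 trace_def mat_def D_def)

text \<open>Unlike the eigenvalues, the trace obeys an exact recursion, and it determines
  \<open>lmax\<close> up to the factor \<open>d\<close>.\<close>

lemma tr_Suc: "tr r (Suc t) = tr r t + 2 * D * wb r t"
proof -
  have "ba r t i s \<bullet> ba r t i s = 1" if "i \<in> {1..CARD('n)}" "\<bar>s\<bar> = 1" for i s
    using norm_ba[OF that, of r t] by (simp add: norm_eq_1)
  then have "(\<Sum>i\<in>{1..CARD('n) - 1}. ba r t i 1 \<bullet> ba r t i 1 + ba r t i (-1) \<bullet> ba r t i (-1))
      = (\<Sum>i\<in>{1..CARD('n) - 1}. 1 + 1)"
    by (intro sum.cong arg_cong2[where f = "(+)"]) auto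
  also have "\<dots> = 2 * D"
    using card2 by (simp add: D_def of_nat_diff)
  finally show ?thesis
    by (simp add: tr_def Vb_Suc trace_add trace_scaleR trace_sum trace_outer)
qed

lemma tr_ge: "(D + 1) * lam0 \<le> tr r t"
  by (induction t) (use tr_0 tr_Suc wb_nonneg D_ge1 in \<open>auto intro!: add_increasing2 mult_nonneg_nonneg\<close>)

lemma lmax_le_tr: "lmax r t \<le> tr r t"
  unfolding lmax_def tr_def by (rule lam_max_le_trace[OF E posdef_Vb])

lemma tr_le_lmax: "tr r t \<le> (D + 1) * lmax r t"
  using trace_le_lam_max[OF E sym_Vb, of r t] by (simp add: lmax_def tr_def D_def)

context
  fixes Tb :: nat and \<delta> :: real
  assumes Tb: "1 \<le> Tb" and \<delta>: "0 < \<delta>" and del0_eq: "del0 = \<delta> / real Tb"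
begin

text \<open>The beta_{T,max} of the theorem, with \<open>T = m * Tb\<close>.\<close>

definition B :: real where
  "B = (lam0 + sqrt (2 * ln (real (m * Tb) / \<delta>)
    + real CARD('n) * ln (1 / (144 * lam0) * (real (m * Tb))\<^sup>2 + 1 / (6 * sqrt lam0) * real (m * Tb) + 1)))\<^sup>2"

text \<open>With \<open>S\<close> for the base of the square, the inductive bound gives an increment
  of at most \<open>(D + 1) * S / 12\<close>, which the growth of \<open>S\<close> by
  \<open>D / 6\<close> covers. The slope \<open>D / 6\<close> is dictated by the theorem:
  \<open>D * Tb / 6 = T / 12\<close>.\<close>

lemma tr_upper: "tr r (Suc t) \<le> (D + 1) * (sqrt lam0 + D * (real t + 2) / 6)\<^sup>2"
proof (induction t)
  case 0
  \<comment> \<open>Gives \<open>2 / 3 * D * sqrt lam0 \<ge> 8 / 9 * D\<close>; the last ninth comes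
    from \<open>D * D / 9\<close>.\<close>
  have s: "4 / 3 \<le> sqrt lam0"
    by (rule real_le_rsqrt) (use lam0 in \<open>simp add: power2_eq_square\<close>)
  have "D * (4 / 3) \<le> D * sqrt lam0"
    using s D_ge1 by (intro mult_left_mono) auto
  moreover have "D * 1 \<le> D * D"
    using D_ge1 by (intro mult_left_mono) auto
  moreover have "(sqrt lam0 + D / 3)\<^sup>2 = lam0 + 2 / 3 * (D * sqrt lam0) + D * D / 9"
  proof -
    have "(s + D / 3)\<^sup>2 = s\<^sup>2 + 2 / 3 * (D * s) + D * D / 9" for s :: real
      by (simp add: power2_eq_square field_simps)
    from this[of "sqrt lam0"] show ?thesis
      using lam0 by simp
  qed
  ultimately have "lam0 + D \<le> (sqrt lam0 + D / 3)\<^sup>2"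
    by linarith
  then have "(D + 1) * (lam0 + D) \<le> (D + 1) * (sqrt lam0 + D / 3)\<^sup>2"
    using D_ge1 by (intro mult_left_mono) auto
  moreover have "tr r (Suc 0) = (D + 1) * lam0 + 2 * D"
    by (simp add: tr_Suc tr_0 wb_def)
  moreover have "2 * D \<le> (D + 1) * D"
    using D_ge1 by (intro mult_right_mono) auto
  ultimately show ?case
    by (simp add: distrib_left)
next
  case (Suc t)
  let ?t = "Suc t" and ?S = "sqrt lam0 + D * (real t + 2) / 6"
  have S: "0 < ?S"
    using lam0 D_ge1 by (intro add_pos_nonneg) auto
  have pos: "2 \<le> beta r ?t" "0 < sqrt D" "0 \<le> lmax r ?t"
    using beta_ge[of r ?t] lmax_ge[of r ?t] lam0 D_ge1 by auto
  have "sqrt (lmax r ?t) \<le> sqrt ((D + 1) * ?S\<^sup>2)"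
    using Suc lmax_le_tr[of r ?t] by (intro real_sqrt_le_mono) linarith
  also have "\<dots> = sqrt (D + 1) * ?S"
    using S by (simp add: real_sqrt_mult)
  finally have l: "sqrt (lmax r ?t) \<le> sqrt (D + 1) * ?S" .
  have "wb r ?t \<le> sqrt (D + 1) * ?S / (12 * sqrt D * 2)"
    unfolding wb_eq[OF zero_less_Suc]
    using l pos S D_ge1 by (intro frac_le mult_left_mono mult_nonneg_nonneg) auto
  then have "2 * D * wb r ?t \<le> 2 * D * (sqrt (D + 1) * ?S / (12 * sqrt D * 2))"
    using D_ge1 by (intro mult_left_mono) auto
  also have "\<dots> = sqrt D * sqrt (D + 1) * (?S / 12)"
  proof -
    have "2 * (s * s) * (x * y / (12 * s * 2)) = s * x * (y / 12)" if "0 < s" for s x y :: real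
      using that by (simp add: field_simps)
    moreover have "0 < sqrt D" "sqrt D * sqrt D = D"
      using D_ge1 by auto
    ultimately show ?thesis
      by metis
  qed
  also have "\<dots> \<le> sqrt (D + 1) * sqrt (D + 1) * (?S / 12)"
    using D_ge1 S by (intro mult_right_mono) auto
  also have "\<dots> = (D + 1) * (?S / 12)"
    using D_ge1 by simp
  finally have "tr r (Suc ?t) \<le> (D + 1) * ?S\<^sup>2 + (D + 1) * (?S / 12)"
    unfolding tr_Suc[of r ?t] using Suc by linarith
  also have "\<dots> = (D + 1) * (?S\<^sup>2 + ?S / 12)"
    by (simp add: distrib_left)
  also have "\<dots> \<le> (D + 1) * (?S + D / 6)\<^sup>2"
  proof (intro mult_left_mono)
    have "y\<^sup>2 + y / 12 \<le> (y + D / 6)\<^sup>2" if "0 < y" for y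
    proof -
      have "y * (1 / 4) \<le> y * D"
        using that D_ge1 by (intro mult_left_mono) auto
      moreover have "(y + D / 6)\<^sup>2 = y\<^sup>2 + y * D / 3 + (D / 6)\<^sup>2"
        by (simp add: power2_eq_square field_simps)
      moreover have "0 \<le> (D / 6)\<^sup>2"
        by simp
      ultimately show ?thesis by linarith
    qed
    from this[OF S] show "?S\<^sup>2 + ?S / 12 \<le> (?S + D / 6)\<^sup>2" .
  qed (use D_ge1 in auto)
  also have "?S + D / 6 = sqrt lam0 + D * (real ?t + 2) / 6"
    by (simp add: algebra_simps add_divide_distrib)
  finally show ?case .
qed

text \<open>For \<open>t = Suc n < Tb\<close> the \<open>n + 2\<close> of \<open>tr_upper\<close> is
  at most \<open>Tb\<close>, and expanding \<open>(sqrt lam0 + T / 12)\<^sup>2 / lam0\<close> gives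
  the argument of the logarithm in \<open>B\<close>.\<close>

lemma tr_bound:
  assumes "t < Tb"
  shows "tr r t / (D + 1) / lam0
    \<le> 1 / (144 * lam0) * (real (m * Tb))\<^sup>2 + 1 / (6 * sqrt lam0) * real (m * Tb) + 1"
proof -
  have *: "tr r t \<le> (D + 1) * (sqrt lam0 + D * real Tb / 6)\<^sup>2"
  proof (cases t)
    case 0
    have "(sqrt lam0)\<^sup>2 \<le> (sqrt lam0 + D * real Tb / 6)\<^sup>2"
      using lam0 D_ge1 by (intro power_mono) auto
    then show ?thesis
      using 0 lam0 D_ge1 by (simp add: tr_0 mult_left_mono)
  next
    case (Suc n)
    have "(sqrt lam0 + D * (real n + 2) / 6)\<^sup>2 \<le> (sqrt lam0 + D * real Tb / 6)\<^sup>2"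
      using assms Suc lam0 D_ge1
      by (intro power_mono add_left_mono divide_right_mono mult_left_mono) auto
    then have "(D + 1) * (sqrt lam0 + D * (real n + 2) / 6)\<^sup>2 \<le> (D + 1) * (sqrt lam0 + D * real Tb / 6)\<^sup>2"
      using D_ge1 by (intro mult_left_mono) auto
    then show ?thesis
      using tr_upper[of r n] Suc by simp
  qed
  then have "tr r t / (D + 1) \<le> (sqrt lam0 + D * real Tb / 6)\<^sup>2"
    using D_ge1 by (simp add: field_simps)
  then have "tr r t / (D + 1) / lam0 \<le> (sqrt lam0 + D * real Tb / 6)\<^sup>2 / lam0"
    using lam0 by (intro divide_right_mono) auto
  also have "\<dots> = 1 / (144 * lam0) * (real (m * Tb))\<^sup>2 + 1 / (6 * sqrt lam0) * real (m * Tb) + 1"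
  proof -
    have "(s + D * real Tb / 6)\<^sup>2 / s\<^sup>2 = 1 / (144 * s\<^sup>2) * (2 * D * real Tb)\<^sup>2 + 1 / (6 * s) * (2 * D * real Tb) + 1"
      if "0 < s" for s :: real
      using that by (simp add: power2_eq_square field_simps)
    from this[of "sqrt lam0"] show ?thesis
      using lam0 by (simp add: real_m)
  qed
  finally show ?thesis .
qed

text \<open>The determinant is bounded through the trace by \<open>ln_det_le\<close>; then
  \<open>Tb\<close> is enlarged to \<open>T\<close> in the confidence term and
  \<open>sqrt lam0\<close> to \<open>lam0\<close>.\<close>

lemma beta_le_B:
  assumes "t < Tb"
  shows "beta r t \<le> B"
proof -
  let ?d = "CARD('n)"
  have d: "real ?d = D + 1"
    by (simp add: D_def)
  have tr0: "0 < tr r t / (D + 1)"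
    using tr_ge[of r t] lam0 D_ge1 by (intro divide_pos_pos) (auto intro: less_le_trans[rotated])
  have detV: "0 < det (Vb r t)"
    by (rule posdef_det_pos[OF E posdef_Vb])
  have "ln (det (Vb r t) / det (mat lam0 :: real^'n^'n)) = ln (det (Vb r t)) - ?d * ln lam0"
    using detV lam0 by (simp add: det_mat ln_div ln_realpow)
  also have "\<dots> \<le> ?d * ln (tr r t / (D + 1)) - ?d * ln lam0"
    using ln_det_le[OF E posdef_Vb, of r t] by (simp add: tr_def d)
  also have "\<dots> = ?d * ln (tr r t / (D + 1) / lam0)"
  proof -
    have "c * ln y - c * ln lam0 = c * ln (y / lam0)" if "0 < y" for c y :: real
      using that lam0 by (simp add: ln_div right_diff_distrib)
    from this[OF tr0] show ?thesis .
  qed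
  also have "\<dots> \<le> ?d * ln (1 / (144 * lam0) * (real (m * Tb))\<^sup>2 + 1 / (6 * sqrt lam0) * real (m * Tb) + 1)"
    using lam0 by (intro mult_left_mono ln_mono tr_bound[OF assms] divide_pos_pos[OF tr0]) auto
  finally have 1: "ln (det (Vb r t) / det (mat lam0 :: real^'n^'n))
      \<le> ?d * ln (1 / (144 * lam0) * (real (m * Tb))\<^sup>2 + 1 / (6 * sqrt lam0) * real (m * Tb) + 1)" .
  have "real 1 * real Tb \<le> real m * real Tb"
    using m_pos by (intro mult_right_mono) auto
  then have "ln (1 / del0) \<le> ln (real (m * Tb) / \<delta>)"
    using \<delta> Tb unfolding del0_eq by (intro ln_mono) (auto intro!: divide_right_mono)
  with 1 have "rho r t \<le> 2 * ln (real (m * Tb) / \<delta>)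
      + ?d * ln (1 / (144 * lam0) * (real (m * Tb))\<^sup>2 + 1 / (6 * sqrt lam0) * real (m * Tb) + 1)"
    by (simp add: rho_def)
  moreover have "sqrt lam0 \<le> lam0"
    using lam0 by (intro real_le_lsqrt) (auto simp: power2_eq_square)
  ultimately show ?thesis
    unfolding beta_eq B_def using lam0 rho_nonneg[of r t]
    by (subst add.commute, intro power_mono add_mono real_sqrt_le_mono) auto
qed

lemma B_ge2: "2 \<le> B"
  using beta_le_B[of 0] beta_ge[of _ 0] lam0 Tb by (metis less_le_trans order_trans zero_less_one)

text \<open>With \<open>c\<close> for the coefficient, the increment is at least
  \<open>13 / 6 * c\<close> times the lower bound on the root of the trace. The offset 6 matches:
  \<open>13 / 6 * 6 = 2 * 6 + 1\<close>, as needed to pass from \<open>(u + 6)\<^sup>2\<close> to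
  \<open>(u + 7)\<^sup>2\<close>.\<close>

lemma tr_lower:
  assumes "Suc t \<le> Tb"
  shows "(sqrt D / (13 * sqrt (D + 1) * B) * (real t + 6))\<^sup>2 \<le> tr r (Suc t)"
  using assms
proof (induction t)
  case 0
  let ?c = "sqrt D / (13 * sqrt (D + 1) * B)"
  have "?c \<le> sqrt (D + 1) / (13 * sqrt (D + 1) * 2)"
    using D_ge1 B_ge2 by (intro frac_le mult_left_mono) auto
  also have "\<dots> = 1 / 26"
    using D_ge1 by simp
  finally have "?c \<le> 1 / 26" .
  then have "?c * 6 \<le> 2"
    by linarith
  then have "(?c * 6)\<^sup>2 \<le> 2\<^sup>2"
    using D_ge1 B_ge2 by (intro power_mono) auto
  also have "\<dots> \<le> (D + 1) * lam0"
    using mult_mono[of 2 "D + 1" 2 lam0] D_ge1 lam0 by simp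
  also have "\<dots> \<le> tr r (Suc 0)"
    by (rule tr_ge)
  finally show ?case by simp
next
  case (Suc t)
  let ?c = "sqrt D / (13 * sqrt (D + 1) * B)" and ?t = "Suc t"
  have c: "0 < ?c"
    using D_ge1 B_ge2 by simp
  have "(?c * (real t + 6))\<^sup>2 \<le> tr r ?t"
    using Suc by simp
  also have "\<dots> \<le> (D + 1) * lmax r ?t"
    by (rule tr_le_lmax)
  finally have s: "?c * (real t + 6) \<le> sqrt (D + 1) * sqrt (lmax r ?t)"
    unfolding real_sqrt_mult[symmetric] by (rule real_le_rsqrt)
  have pos: "0 < beta r ?t" "beta r ?t \<le> B" "0 < sqrt D" "0 \<le> sqrt (lmax r ?t)" "0 < sqrt (D + 1)" "0 < B"
    using beta_ge[of r ?t] beta_le_B[of ?t r] lmax_ge[of r ?t] lam0 D_ge1 Suc.prems B_ge2 by auto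
  have "2 * x * (x * (u + 6)) + x\<^sup>2 \<le> (13 / 6 * x) * (x * (u + 6))" if "0 \<le> u" for x u :: real
  proof -
    have "x\<^sup>2 * (2 * u + 13) \<le> x\<^sup>2 * (13 / 6 * u + 13)"
      using that by (intro mult_left_mono) auto
    then show ?thesis
      by (simp add: power2_eq_square algebra_simps)
  qed
  from this[of "real t" ?c]
  have "2 * ?c * (?c * (real t + 6)) + ?c\<^sup>2 \<le> (13 / 6 * ?c) * (?c * (real t + 6))"
    by simp
  also have "\<dots> \<le> (13 / 6 * ?c) * (sqrt (D + 1) * sqrt (lmax r ?t))"
    using s D_ge1 B_ge2 by (intro mult_left_mono) auto
  also have "\<dots> = 2 * (sqrt D * sqrt D) * (sqrt (lmax r ?t) / (12 * sqrt D * B))"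
    using pos by (simp add: field_simps)
  also have "\<dots> \<le> 2 * D * wb r ?t"
    unfolding wb_eq[OF zero_less_Suc] using pos D_ge1
    by (intro mult_mono divide_left_mono) auto
  finally have "(?c * (real t + 6))\<^sup>2 + (2 * ?c * (?c * (real t + 6)) + ?c\<^sup>2) \<le> tr r (Suc ?t)"
    unfolding tr_Suc[of r ?t] using Suc by simp
  moreover have "(x * (u + 6))\<^sup>2 + (2 * x * (x * (u + 6)) + x\<^sup>2) = (x * (1 + u + 6))\<^sup>2" for x u :: real
    by (simp add: power2_eq_square algebra_simps)
  ultimately show ?case
    by (simp only: of_nat_Suc)
qed

lemma round_regret:
  assumes "good r t" "0 < t" "t < Tb" "k div m = t"
  shows "1 - \<theta> \<bullet> act r k \<le> 64 * (D + 1) * B\<^sup>2 / (real t + 1)"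
proof -
  have pos: "0 < beta r t" "beta r t \<le> B" "0 < sqrt D" "0 < lmin r t" "0 < sqrt (D + 1)" "0 < B"
    using beta_ge[of r t] beta_le_B[of t r] lmin_ge[of r t] lam0 D_ge1 assms(3) B_ge2 by auto
  obtain n where n: "t = Suc n"
    using assms(2) by (cases t) auto
  let ?c = "sqrt D / (13 * sqrt (D + 1) * B)"
  have "(?c * (real t + 5))\<^sup>2 \<le> (D + 1) * lmax r t"
    using tr_lower[of n r] tr_le_lmax[of r t] n assms(3) by (simp add: add.commute)
  then have "?c * (real t + 5) \<le> sqrt (D + 1) * sqrt (lmax r t)"
    unfolding real_sqrt_mult[symmetric] by (rule real_le_rsqrt)
  moreover have "?c * (real t + 1) \<le> ?c * (real t + 5)"
    using pos by (intro mult_left_mono) auto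
  ultimately have 1: "?c * (real t + 1) \<le> sqrt (D + 1) * sqrt (lmax r t)"
    by linarith
  \<comment> \<open>The 13 cancels the one in \<open>?c\<close>, leaving
    \<open>lmin \<ge> (t + 1) / (16 * (D + 1) * B)\<close>; with the factor 4 of
    \<open>good_act\<close> this makes 64.\<close>
  have q: "13 / 16 \<le> sqrt (2 / 3)"
    by (rule real_le_rsqrt) (simp add: power2_eq_square)
  have "13 / 16 * sqrt (lmax r t) \<le> sqrt (2 / 3) * sqrt (lmax r t)"
    using q lmax_ge[of r t] lam0 by (intro mult_right_mono) auto
  also have "\<dots> \<le> sqrt D * lmin r t"
    by (rule lmin_ge_sqrt_lmax[OF assms(2)])
  finally have "13 / 16 * (sqrt (D + 1) * sqrt (lmax r t)) \<le> sqrt (D + 1) * (sqrt D * lmin r t)"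
    using pos by (simp add: mult_ac)
  with 1 have "13 / 16 * (?c * (real t + 1)) \<le> sqrt (D + 1) * (sqrt D * lmin r t)"
    by linarith
  then have "16 * sqrt (D + 1) * B * (13 / 16 * (?c * (real t + 1)))
      \<le> 16 * sqrt (D + 1) * B * (sqrt (D + 1) * (sqrt D * lmin r t))"
    using pos by (intro mult_left_mono) auto
  also have "16 * sqrt (D + 1) * B * (13 / 16 * (?c * (real t + 1))) = sqrt D * (real t + 1)"
    using pos by (simp add: field_simps)
  also have "16 * sqrt (D + 1) * B * (sqrt (D + 1) * (sqrt D * lmin r t))
      = sqrt D * (16 * (sqrt (D + 1) * sqrt (D + 1)) * B * lmin r t)"
    by (simp only: mult_ac)
  finally have "sqrt D * (real t + 1) \<le> sqrt D * (16 * (sqrt (D + 1) * sqrt (D + 1)) * B * lmin r t)" .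
  then have L: "real t + 1 \<le> 16 * (D + 1) * B * lmin r t"
    using pos D_ge1 by simp
  have "1 - \<theta> \<bullet> act r k \<le> 4 * beta r t / lmin r t"
    using good_act(2)[of r k] assms by simp
  also have "\<dots> \<le> 4 * B / lmin r t"
    using pos by (intro divide_right_mono) auto
  also have "\<dots> \<le> 64 * (D + 1) * B\<^sup>2 / (real t + 1)"
    using mult_left_mono[OF L, of "4 * B"] pos by (simp add: field_simps power2_eq_square)
  finally show ?thesis .
qed

text \<open>The first batch costs at most 2 per round. Batch index \<open>t > 0\<close> costs at
  most \<open>128 * D * (D + 1) * B\<^sup>2 / (t + 1)\<close>, and
  \<open>1 / (t + 1) \<le> ln (t + 1) - ln t\<close> telescopes.\<close>

lemma regret_bound:
  assumes good: "\<And>t. 0 < t \<Longrightarrow> t < Tb \<Longrightarrow> good r t" and n: "Suc n \<le> Tb"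
  shows "regret \<theta> (act r) (m * Suc n) \<le> 4 * D + 144 * (D + 1)\<^sup>2 * B\<^sup>2 * ln (real (Suc n))"
  using n
proof (induction n)
  case 0
  have "1 - \<theta> \<bullet> act r k \<le> 2" for k
    using Cauchy_Schwarz_ineq2[of \<theta> "act r k"] \<theta> norm_act[of r k] by simp
  then have "regret \<theta> (act r) m \<le> (\<Sum>k<m. 2)"
    unfolding regret_def by (rule sum_mono)
  then show ?case by (simp add: real_m)
next
  case (Suc n)
  let ?t = "Suc n"
  have dv: "(m * ?t + j) div m = ?t" if "j < m" for j
    using that m_pos by (simp only: div_mult_self4 div_less)
  have "regret \<theta> (act r) (m * Suc ?t) = regret \<theta> (act r) (m * ?t) + (\<Sum>j<m. 1 - \<theta> \<bullet> act r (m * ?t + j))"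
    unfolding regret_def using sum_lessThan_add[of "\<lambda>k. 1 - \<theta> \<bullet> act r k" "m * ?t" m]
    by (simp add: add.commute)
  also have "(\<Sum>j<m. 1 - \<theta> \<bullet> act r (m * ?t + j)) \<le> (\<Sum>j<m. 64 * (D + 1) * B\<^sup>2 / (real ?t + 1))"
    using Suc.prems by (intro sum_mono round_regret good dv) auto
  also have "\<dots> = 128 * (D * (D + 1)) * B\<^sup>2 * (1 / (real ?t + 1))"
    by (simp add: real_m)
  also have "\<dots> \<le> 144 * ((D + 1) * (D + 1)) * B\<^sup>2 * (ln (real (Suc ?t)) - ln (real ?t))"
  proof (intro mult_mono)
    have "ln (real ?t / real (Suc ?t)) \<le> real ?t / real (Suc ?t) - 1"
      by (rule ln_le_minus_one) simp
    then show "1 / (real ?t + 1) \<le> ln (real (Suc ?t)) - ln (real ?t)"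
      by (simp add: ln_div field_simps)
  qed (use D_ge1 in \<open>auto intro!: mult_right_mono\<close>)
  finally show ?case
    using Suc by (simp add: power2_eq_square algebra_simps)
qed

end

end

section \<open>Measurability and concentration\<close>

lemma borel_measurable_vec_nth:
  fixes f :: "'a \<Rightarrow> 'b::euclidean_space^'n"
  assumes "f \<in> borel_measurable M"
  shows "(\<lambda>x. f x $ i) \<in> borel_measurable M"
  using assms by (rule measurable_compose) (intro borel_measurable_continuous_onI continuous_intros)

lemma borel_measurable_vecI:
  fixes f :: "'a \<Rightarrow> 'b::euclidean_space^'n"
  assumes "\<And>i. (\<lambda>x. f x $ i) \<in> borel_measurable M"
  shows "f \<in> borel_measurable M"
proof (subst borel_measurable_euclidean_space, intro ballI)
  fix e :: "'b^'n" assume "e \<in> Basis"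
  then obtain i u where "e = axis i u"
    by (auto simp: Basis_vec_def)
  then show "(\<lambda>x. f x \<bullet> e) \<in> borel_measurable M"
    using assms[of i] by (simp add: inner_axis borel_measurable_inner)
qed

lemma borel_measurable_outer:
  fixes f g :: "'a \<Rightarrow> real^'n"
  assumes "f \<in> borel_measurable M" "g \<in> borel_measurable M"
  shows "(\<lambda>x. outer (f x) (g x)) \<in> borel_measurable M"
  by (intro borel_measurable_vecI) (simp add: outer_def borel_measurable_times borel_measurable_vec_nth assms)

lemma borel_measurable_det:
  fixes V :: "'a \<Rightarrow> real^'n^'n"
  assumes "V \<in> borel_measurable M"
  shows "(\<lambda>x. det (V x)) \<in> borel_measurable M"
  unfolding det_def
  by (intro borel_measurable_sum borel_measurable_times borel_measurable_prod borel_measurable_const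
      borel_measurable_vec_nth assms)

text \<open>Cramer's rule expresses the inverse by quotients of determinants, which are polynomials
  in measurable entries.\<close>

lemma borel_measurable_matrix_inv_mult:
  fixes V :: "'a \<Rightarrow> real^'n^'n"
  assumes V: "V \<in> borel_measurable M" and f: "f \<in> borel_measurable M"
    and pd: "\<And>x. x \<in> space M \<Longrightarrow> posdef (V x)"
  shows "(\<lambda>x. matrix_inv (V x) *v f x) \<in> borel_measurable M"
proof -
  have "matrix_inv (V x) *v f x = (\<chi> k. det (\<chi> i j. if j = k then f x $ i else V x $ i $ j) / det (V x))"
    if "x \<in> space M" for x
  proof -
    have "det (V x) \<noteq> 0"
      using posdef_invertible[OF pd[OF that]] by (simp add: invertible_det_nz)
    then show ?thesis
      using cramer[of "V x" "matrix_inv (V x) *v f x" "f x"] mult_matrix_inv_vec[OF pd[OF that]] by blast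
  qed
  moreover have "(\<lambda>x. \<chi> k. det (\<chi> i j. if j = k then f x $ i else V x $ i $ j) / det (V x)) \<in> borel_measurable M"
  proof (intro borel_measurable_vecI)
    fix k
    have "(\<lambda>x. (\<chi> i j. if j = k then f x $ i else V x $ i $ j) :: real^'n^'n) \<in> borel_measurable M"
    proof (intro borel_measurable_vecI)
      fix i j
      show "(\<lambda>x. (\<chi> i j. if j = k then f x $ i else V x $ i $ j) $ i $ j) \<in> borel_measurable M"
        by (cases "j = k") (simp_all add: borel_measurable_vec_nth V f)
    qed
    then show "(\<lambda>x. (\<chi> k. det (\<chi> i j. if j = k then f x $ i else V x $ i $ j) / det (V x)) $ k) \<in> borel_measurable M"
      by (simp add: borel_measurable_det borel_measurable_divide V)
  qed
  ultimately show ?thesis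
    by (simp cong: measurable_cong)
qed

text \<open>A sublevel set is an intersection of closed sets, one per test vector, hence closed
  although the family is uncountable.\<close>

lemma borel_measurable_lam_max:
  fixes V :: "'a \<Rightarrow> real^'n^'n" and E :: "real^'n^'n \<Rightarrow> nat \<Rightarrow> real^'n"
  assumes E: "eig_selector E" and V: "V \<in> borel_measurable M"
    and sym: "\<And>x. x \<in> space M \<Longrightarrow> transpose (V x) = V x"
  shows "(\<lambda>x. lam_max (V x)) \<in> borel_measurable M"
  unfolding borel_measurable_iff_le
proof
  fix a
  let ?C = "\<Inter>y. {W :: real^'n^'n. y \<bullet> (W *v y) \<le> a * (y \<bullet> y)}"
  have "closed ?C"
    unfolding matrix_vector_mult_def inner_vec_def
    by (intro closed_INT ballI closed_Collect_le continuous_intros)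
  then have "V -` ?C \<inter> space M \<in> sets M"
    using V by (intro measurable_sets) auto
  also have "V -` ?C \<inter> space M = {w \<in> space M. lam_max (V w) \<le> a}"
    using lam_max_le_iff[OF E sym] by auto
  finally show "{w \<in> space M. lam_max (V w) \<le> a} \<in> sets M" .
qed

section \<open>The history sigma-algebra\<close>

lemma space_hist_alg: "space (hist_alg M A R k) = space M"
  unfolding hist_alg_def by (rule space_measure_of) auto

lemma hist_alg_action:
  fixes A :: "nat \<Rightarrow> 'a \<Rightarrow> real^'n"
  assumes "j \<le> k"
  shows "A j \<in> borel_measurable (hist_alg M A R k)"
proof (rule measurableI)
  fix B :: "(real^'n) set" assume "B \<in> sets borel"
  then have "A j -` B \<inter> space M \<in> sigma_sets (space M)
     ({A j -` B \<inter> space M | j B. j \<le> k \<and> B \<in> sets borel} \<union>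
      {R j -` B \<inter> space M | j B. j < k \<and> B \<in> sets borel})"
    using assms by (intro sigma_sets.Basic) auto
  then show "A j -` B \<inter> space (hist_alg M A R k) \<in> sets (hist_alg M A R k)"
    unfolding space_hist_alg unfolding hist_alg_def by (subst sets_measure_of) auto
qed simp

lemma hist_alg_reward:
  fixes A :: "nat \<Rightarrow> 'a \<Rightarrow> real^'n"
  assumes "j < k"
  shows "R j \<in> borel_measurable (hist_alg M A R k)"
proof (rule measurableI)
  fix B :: "real set" assume "B \<in> sets borel"
  then have "R j -` B \<inter> space M \<in> sigma_sets (space M)
     ({A j -` B \<inter> space M | j B. j \<le> k \<and> B \<in> sets borel} \<union>
      {R j -` B \<inter> space M | j B. j < k \<and> B \<in> sets borel})"
    using assms by (intro sigma_sets.Basic) auto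
  then show "R j -` B \<inter> space (hist_alg M A R k) \<in> sets (hist_alg M A R k)"
    unfolding space_hist_alg unfolding hist_alg_def by (subst sets_measure_of) auto
qed simp

lemma hist_alg_subalgebra:
  fixes A :: "nat \<Rightarrow> 'a \<Rightarrow> real^'n"
  assumes "\<And>j. j \<le> k \<Longrightarrow> A j \<in> borel_measurable M" "\<And>j. j < k \<Longrightarrow> R j \<in> borel_measurable M"
  shows "subalgebra M (hist_alg M A R k)"
  unfolding subalgebra_def space_hist_alg unfolding hist_alg_def
  by (subst sets_measure_of, blast, intro conjI refl sets.sigma_sets_subset)
     (auto intro: measurable_sets assms)

section \<open>The self-normalised exponential process\<close>

context linucb_vn
begin

text \<open>The closed form of the mixture \<open>\<integral> exp (x \<bullet> N - x \<bullet> ((V - V\<^sub>0) *v x) / 2) d\<N>(0, V\<^sub>0\<^sup>-\<^sup>1)\<close>.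
  The factor gained in one round is a one-dimensional Gaussian mixture (lemma \<open>normal_mixture\<close>), so the
  multivariate integral is never needed.\<close>
definition Zr where
  "Zr r k = exp ((Nr r k \<bullet> (matrix_inv (Vr r k) *v Nr r k)) / 2)
    / sqrt (det (Vr r k) / det (mat lam0 :: real^'n^'n))"

definition bvec where "bvec r k = sqrt (wr r k) *\<^sub>R act r k"
definition pr where "pr r k = bvec r k \<bullet> (matrix_inv (Vr r k) *v Nr r k)"
definition qr where "qr r k = bvec r k \<bullet> (matrix_inv (Vr r k) *v bvec r k)"

lemma Zr_0: "Zr r 0 = 1"
  using det_mat_lam0_pos by (simp add: Zr_def Nr_def Vr_def)

lemma det_Vr_pos: "0 < det (Vr r k)"
  by (rule posdef_det_pos[OF E posdef_Vr])

lemma Zr_nonneg: "0 \<le> Zr r k"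
  using det_Vr_pos[of r k] det_mat_lam0_pos by (simp add: Zr_def)

text \<open>The exponent comes from the update of the quadratic form, the root from the determinant
  update; together they are the value in \<open>normal_mixture\<close>.\<close>

lemma Zr_Suc:
  defines "\<eta> \<equiv> \<lambda>r k. sqrt (wr r k) * (r k - \<theta> \<bullet> act r k)"
  shows "Zr r (Suc k) = Zr r k * (exp ((2 * pr r k * \<eta> r k + qr r k * (\<eta> r k)\<^sup>2 - (pr r k)\<^sup>2)
    / (2 * (1 + qr r k))) / sqrt (1 + qr r k))"
proof -
  let ?b = "bvec r k"
  have N: "Nr r (Suc k) = Nr r k + \<eta> r k *\<^sub>R ?b"
    using wr_nonneg[of r k] by (simp add: Nr_Suc bvec_def \<eta>_def mult_ac)
  have V: "Vr r (Suc k) = Vr r k + outer ?b ?b"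
    by (simp add: Vr_Suc_outer bvec_def)
  have "Nr r (Suc k) \<bullet> (matrix_inv (Vr r (Suc k)) *v Nr r (Suc k))
      = Nr r k \<bullet> (matrix_inv (Vr r k) *v Nr r k)
        + (2 * pr r k * \<eta> r k + qr r k * (\<eta> r k)\<^sup>2 - (pr r k)\<^sup>2) / (1 + qr r k)"
    unfolding N V pr_def qr_def by (rule matrix_inv_form_update[OF posdef_Vr])
  moreover have "det (Vr r (Suc k)) = (1 + qr r k) * det (Vr r k)"
    unfolding V qr_def by (rule det_add_outer[OF posdef_Vr])
  moreover have "exp ((x + y / (1 + q)) / 2) / sqrt ((1 + q) * u / v)
      = exp (x / 2) / sqrt (u / v) * (exp (y / (2 * (1 + q))) / sqrt (1 + q))"
    for x y u v q :: real
    by (simp add: add_divide_distrib exp_add real_sqrt_mult real_sqrt_divide mult_ac)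
  ultimately show ?thesis
    unfolding Zr_def by simp
qed

lemma Zr_ge_if_not_good:
  assumes "\<not> good r t"
  shows "1 / del0 \<le> Zr r (m * t)"
proof -
  let ?u = "det (Vr r (m * t)) / det (mat lam0 :: real^'n^'n)"
  have u: "0 < ?u"
    using det_Vr_pos det_mat_lam0_pos by simp
  have "ln (1 / del0) + ln ?u / 2 \<le> (Nr r (m * t) \<bullet> (matrix_inv (Vr r (m * t)) *v Nr r (m * t))) / 2"
    using assms by (simp add: good_def rho_def Vb_eq_Vr)
  then have "exp (ln (1 / del0) + ln ?u / 2)
      \<le> exp ((Nr r (m * t) \<bullet> (matrix_inv (Vr r (m * t)) *v Nr r (m * t))) / 2)"
    by simp
  moreover have "exp (ln (1 / del0) + ln ?u / 2) = 1 / del0 * sqrt ?u"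
    using del0 u by (simp only: exp_add exp_ln ln_sqrt[symmetric] zero_less_divide_1_iff real_sqrt_gt_0_iff)
  ultimately show ?thesis
    using u by (simp add: Zr_def pos_le_divide_eq)
qed

end

section \<open>The restricted supermartingale and the failure probability\<close>

locale linucb_vn_bandit = linucb_vn lam0 del0 E th0 \<theta> + prob_space M
  for lam0 del0 :: real and E :: "real^'n^'n \<Rightarrow> nat \<Rightarrow> real^'n" and th0 \<theta> :: "real^'n"
    and M :: "'a measure" +
  fixes A :: "nat \<Rightarrow> 'a \<Rightarrow> real^'n" and R \<epsilon> \<sigma> :: "nat \<Rightarrow> 'a \<Rightarrow> real" and K :: nat
  assumes alg: "\<And>k \<omega>. k < K \<Longrightarrow> \<omega> \<in> space M \<Longrightarrow> A k \<omega> = act (\<lambda>j. R j \<omega>) k"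
    and rew: "\<And>k \<omega>. k < K \<Longrightarrow> \<omega> \<in> space M \<Longrightarrow> R k \<omega> = \<theta> \<bullet> A k \<omega> + \<epsilon> k \<omega>"
    and A_meas: "\<And>k. k < K \<Longrightarrow> A k \<in> borel_measurable M"
    and \<epsilon>_meas: "\<And>k. k < K \<Longrightarrow> \<epsilon> k \<in> borel_measurable M"
    and subg: "\<And>k \<mu>. k < K \<Longrightarrow>
                  AE \<omega> in M. nn_cond_exp M (hist_alg M A R k) (\<lambda>x. ennreal (exp (\<mu> * \<epsilon> k x))) \<omega>
                     \<le> ennreal (exp (\<mu>\<^sup>2 * (\<sigma> k \<omega>)\<^sup>2 / 2))"
    and \<sigma>_bd: "\<And>k \<omega>. k < K \<Longrightarrow> \<omega> \<in> space M \<Longrightarrow> (\<sigma> k \<omega>)\<^sup>2 \<le> 1 - (\<theta> \<bullet> A k \<omega>)\<^sup>2"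
begin

abbreviation rewards where "rewards \<omega> \<equiv> (\<lambda>j. R j \<omega>)"
abbreviation F where "F \<equiv> hist_alg M A R"

lemma R_meas: "k < K \<Longrightarrow> R k \<in> borel_measurable M"
  using A_meas \<epsilon>_meas by (subst measurable_cong[OF rew]) auto

lemma subalgebra_F: "k < K \<Longrightarrow> subalgebra M (F k)"
  by (rule hist_alg_subalgebra) (auto intro: A_meas R_meas)

text \<open>\<open>N\<close> is instantiated with \<open>F k\<close> for the supermartingale step
  and with \<open>M\<close> and \<open>k = K\<close> for the events.\<close>

context
  fixes N :: "'a measure" and k :: nat
  assumes space_N: "space N = space M" and k: "k \<le> K"
    and act_N: "\<And>j. j < k \<Longrightarrow> A j \<in> borel_measurable N"
begin

lemma wb_measurable:
  assumes V: "(\<lambda>\<omega>. Vr (rewards \<omega>) (m * t)) \<in> borel_measurable N"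
  shows "(\<lambda>\<omega>. wb (rewards \<omega>) t) \<in> borel_measurable N"
proof (cases "t = 0")
  case False
  then show ?thesis
    unfolding wb_def omega_w_def beta_conf_def Vb_eq_Vr if_False
    by (simp only: if_False)
       (intro borel_measurable_divide borel_measurable_times borel_measurable_const
        borel_measurable_power borel_measurable_add measurable_compose[OF _ borel_measurable_sqrt]
        borel_measurable_ln borel_measurable_lam_max[OF E] borel_measurable_det V posdef_symmetric posdef_Vr)
qed (simp add: wb_def)

text \<open>The algorithm's action is replaced by the variable \<open>A i\<close>, since the formula
  for it involves \<open>E\<close>. The induction is strong because a weight refers back to the
  start of its batch.\<close>

lemma Vr_measurable: "j \<le> k \<Longrightarrow> (\<lambda>\<omega>. Vr (rewards \<omega>) j) \<in> borel_measurable N"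
proof (induction j rule: less_induct)
  case (less j)
  show ?case
  proof (cases j)
    case 0
    then show ?thesis by (simp add: Vr_def)
  next
    case (Suc i)
    have "m * (i div m) < j"
      using Suc by (simp add: le_imp_less_Suc)
    then have "(\<lambda>\<omega>. wr (rewards \<omega>) i) \<in> borel_measurable N"
      unfolding wr_def using less by (intro wb_measurable) auto
    moreover have "(\<lambda>\<omega>. Vr (rewards \<omega>) i) \<in> borel_measurable N"
      using less Suc by simp
    ultimately have "(\<lambda>\<omega>. Vr (rewards \<omega>) i + wr (rewards \<omega>) i *\<^sub>R outer (A i \<omega>) (A i \<omega>)) \<in> borel_measurable N"
      using act_N[of i] less.prems Suc
      by (intro borel_measurable_add borel_measurable_scaleR borel_measurable_outer) auto
    moreover have "Vr (rewards \<omega>) j = Vr (rewards \<omega>) i + wr (rewards \<omega>) i *\<^sub>R outer (A i \<omega>) (A i \<omega>)"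
      if "\<omega> \<in> space N" for \<omega>
      using that less.prems Suc k alg[of i \<omega>] space_N by (simp add: Vr_Suc)
    ultimately show ?thesis
      by (subst measurable_cong)
  qed
qed

text \<open>Predictability: a weight is settled when its batch starts, so \<open>i = k\<close> is
  covered.\<close>

lemma wr_measurable:
  assumes "m * (i div m) \<le> k"
  shows "(\<lambda>\<omega>. wr (rewards \<omega>) i) \<in> borel_measurable N"
  unfolding wr_def using assms by (intro wb_measurable Vr_measurable)

context
  assumes rew_N: "\<And>j. j < k \<Longrightarrow> R j \<in> borel_measurable N"
begin

lemma Nr_measurable:
  assumes "j \<le> k"
  shows "(\<lambda>\<omega>. Nr (rewards \<omega>) j) \<in> borel_measurable N"
proof -
  have "Nr (rewards \<omega>) j = (\<Sum>i<j. (wr (rewards \<omega>) i * (R i \<omega> - \<theta> \<bullet> A i \<omega>)) *\<^sub>R A i \<omega>)"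
    if "\<omega> \<in> space N" for \<omega>
    using that assms k by (simp add: Nr_def alg space_N)
  moreover have "(\<lambda>\<omega>. \<Sum>i<j. (wr (rewards \<omega>) i * (R i \<omega> - \<theta> \<bullet> A i \<omega>)) *\<^sub>R A i \<omega>) \<in> borel_measurable N"
  proof (intro borel_measurable_sum)
    fix i assume "i \<in> {..<j}"
    then have i: "i < k" "m * (i div m) \<le> k"
      using assms by (auto intro: order_trans[OF times_div_less_eq_dividend])
    show "(\<lambda>\<omega>. (wr (rewards \<omega>) i * (R i \<omega> - \<theta> \<bullet> A i \<omega>)) *\<^sub>R A i \<omega>) \<in> borel_measurable N"
      by (intro borel_measurable_scaleR borel_measurable_times borel_measurable_diff
          borel_measurable_inner borel_measurable_const wr_measurable act_N rew_N i)
  qed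
  ultimately show ?thesis
    by (simp cong: measurable_cong)
qed

lemma form_measurable:
  assumes "j \<le> k"
  shows "(\<lambda>\<omega>. Nr (rewards \<omega>) j \<bullet> (matrix_inv (Vr (rewards \<omega>) j) *v Nr (rewards \<omega>) j)) \<in> borel_measurable N"
  by (intro borel_measurable_inner borel_measurable_matrix_inv_mult Nr_measurable Vr_measurable assms posdef_Vr)

lemma Zr_measurable:
  assumes "j \<le> k"
  shows "(\<lambda>\<omega>. Zr (rewards \<omega>) j) \<in> borel_measurable N"
  unfolding Zr_def
  by (intro borel_measurable_divide borel_measurable_const measurable_compose[OF _ borel_measurable_sqrt]
      measurable_compose[OF _ borel_measurable_exp] form_measurable borel_measurable_det Vr_measurable assms)

lemma good_measurable:
  assumes "m * t \<le> k"
  shows "{\<omega> \<in> space M. good (rewards \<omega>) t} \<in> sets N"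
  unfolding good_def rho_def Vb_eq_Vr space_N[symmetric]
  by (intro borel_measurable_le form_measurable borel_measurable_add borel_measurable_const
      borel_measurable_ln borel_measurable_divide borel_measurable_det Vr_measurable assms)

end

end

text \<open>The range starts at 1 because the direction used in the first batch is not an
  estimate.\<close>

definition G where "G t = {\<omega> \<in> space M. \<forall>s. 0 < s \<and> s \<le> t \<longrightarrow> good (rewards \<omega>) s}"

lemma G_antimono: "s \<le> t \<Longrightarrow> G t \<subseteq> G s"
  by (auto simp: G_def)

lemma G_measurable:
  assumes "space N = space M" "k \<le> K" "\<And>j. j < k \<Longrightarrow> A j \<in> borel_measurable N"
    "\<And>j. j < k \<Longrightarrow> R j \<in> borel_measurable N" "m * t \<le> k"
  shows "G t \<in> sets N"
proof -
  have "G t = space N \<inter> (\<Inter>s\<in>{1..t}. {\<omega> \<in> space M. good (rewards \<omega>) s})" if "0 < t"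
    using that assms(1) by (auto simp: G_def)
  moreover have "{\<omega> \<in> space M. good (rewards \<omega>) s} \<in> sets N" if "s \<in> {1..t}" for s
    using that by (intro good_measurable[OF assms(1-4)] order_trans[OF _ assms(5)]) auto
  moreover have "G 0 = space N"
    using assms(1) by (auto simp: G_def)
  ultimately show ?thesis
    by (cases "t = 0") (auto intro!: sets.finite_INT)
qed

text \<open>The indicator is known at round \<open>k\<close> because the current batch starts at
  \<open>m * (k div m) \<le> k\<close>. On the event \<open>weight_le\<close> applies, off it the
  integrand vanishes.\<close>

lemma supermartingale_step:
  assumes k: "k < K"
  shows "(\<integral>\<^sup>+\<omega>. ennreal (indicator (G (k div m)) \<omega> * Zr (rewards \<omega>) (Suc k)) \<partial>M)
    \<le> (\<integral>\<^sup>+\<omega>. ennreal (indicator (G (k div m)) \<omega> * Zr (rewards \<omega>) k) \<partial>M)"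
proof -
  let ?N = "F k"
  let ?r = rewards
  interpret finite_measure_subalgebra M ?N
    by unfold_locales (rule subalgebra_F[OF k])
  note N = space_hist_alg[of M A R k] less_imp_le[OF k]
  have A_N: "A j \<in> borel_measurable ?N" if "j \<le> k" for j
    using that by (rule hist_alg_action)
  have R_N: "R j \<in> borel_measurable ?N" if "j < k" for j
    using that by (rule hist_alg_reward)
  have A_N': "A j \<in> borel_measurable ?N" if "j < k" for j
    using that by (intro A_N) simp
  have mk: "m * (k div m) \<le> k"
    by simp
  define b where "b \<omega> = sqrt (wr (?r \<omega>) k) *\<^sub>R A k \<omega>" for \<omega>
  \<comment> \<open>Stands in for the variance proxy \<open>(\<sigma> k \<omega>)\<^sup>2\<close>,
    whose measurability is not assumed.\<close>
  define v where "v \<omega> = 1 - (\<theta> \<bullet> A k \<omega>)\<^sup>2" for \<omega>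
  define p where "p \<omega> = b \<omega> \<bullet> (matrix_inv (Vr (?r \<omega>) k) *v Nr (?r \<omega>) k)" for \<omega>
  define q where "q \<omega> = b \<omega> \<bullet> (matrix_inv (Vr (?r \<omega>) k) *v b \<omega>)" for \<omega>
  have w_meas: "(\<lambda>\<omega>. wr (?r \<omega>) k) \<in> borel_measurable ?N"
    by (rule wr_measurable[OF N A_N' mk])
  have b_meas: "b \<in> borel_measurable ?N"
    unfolding b_def[abs_def]
    by (intro borel_measurable_scaleR measurable_compose[OF w_meas borel_measurable_sqrt] A_N) simp
  have v_meas: "v \<in> borel_measurable ?N"
    unfolding v_def[abs_def]
    by (intro borel_measurable_diff borel_measurable_power borel_measurable_inner borel_measurable_const A_N) simp
  have Vr_meas: "(\<lambda>\<omega>. Vr (?r \<omega>) k) \<in> borel_measurable ?N"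
    by (rule Vr_measurable[OF N A_N' order_refl])
  have p_meas: "p \<in> borel_measurable ?N"
    unfolding p_def[abs_def]
    by (intro borel_measurable_inner b_meas borel_measurable_matrix_inv_mult Vr_meas posdef_Vr
        Nr_measurable[OF N A_N' R_N order_refl])
  have q_meas: "q \<in> borel_measurable ?N"
    unfolding q_def[abs_def]
    by (intro borel_measurable_inner b_meas borel_measurable_matrix_inv_mult Vr_meas posdef_Vr)
  have Z_meas: "(\<lambda>\<omega>. indicator (G (k div m)) \<omega> * Zr (?r \<omega>) k) \<in> borel_measurable ?N"
    by (intro borel_measurable_times borel_measurable_indicator G_measurable[OF N A_N' R_N mk]
        Zr_measurable[OF N A_N' R_N order_refl])
  have v0: "0 \<le> v \<omega>" if "\<omega> \<in> space M" for \<omega>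
    using Cauchy_Schwarz_ineq2[of \<theta> "A k \<omega>"] \<theta> norm_act[of "?r \<omega>" k] alg[OF k that]
    by (simp add: v_def abs_square_le_1)
  have sg: "AE \<omega> in M. nn_cond_exp M ?N (\<lambda>x. ennreal (exp (\<mu> * \<epsilon> k x))) \<omega> \<le> ennreal (exp (\<mu>\<^sup>2 * v \<omega> / 2))" for \<mu>
    using subg[OF k, of \<mu>] AE_space
  proof eventually_elim
    case (elim \<omega>)
    have "\<mu>\<^sup>2 * (\<sigma> k \<omega>)\<^sup>2 \<le> \<mu>\<^sup>2 * v \<omega>"
      unfolding v_def by (intro mult_left_mono \<sigma>_bd k elim) simp
    then show ?case
      by (intro order_trans[OF elim(1)] ennreal_leI) simp
  qed
  have wv: "wr (?r \<omega>) k * v \<omega> \<le> 1"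
    if "\<omega> \<in> space M" "indicator (G (k div m)) \<omega> * Zr (?r \<omega>) k \<noteq> 0" for \<omega>
  proof -
    have "\<omega> \<in> G (k div m)"
      using that(2) by (auto simp: indicator_def split: if_splits)
    then show ?thesis
      unfolding v_def alg[OF k that(1)] by (intro weight_le) (auto simp: G_def)
  qed
  have q0: "0 \<le> q \<omega>" for \<omega>
    unfolding q_def by (rule matrix_inv_form_nonneg[OF posdef_Vr])
  have "(\<integral>\<^sup>+\<omega>. ennreal (indicator (G (k div m)) \<omega> * Zr (?r \<omega>) (Suc k)) \<partial>M)
      = (\<integral>\<^sup>+\<omega>. ennreal ((indicator (G (k div m)) \<omega> * Zr (?r \<omega>) k)
          * (exp ((2 * p \<omega> * (sqrt (wr (?r \<omega>) k) * \<epsilon> k \<omega>) + q \<omega> * (sqrt (wr (?r \<omega>) k) * \<epsilon> k \<omega>)\<^sup>2 - (p \<omega>)\<^sup>2)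
              / (2 * (1 + q \<omega>))) / sqrt (1 + q \<omega>))) \<partial>M)"
  proof (rule nn_integral_cong)
    fix \<omega> assume \<omega>: "\<omega> \<in> space M"
    have e: "R k \<omega> - \<theta> \<bullet> act (?r \<omega>) k = \<epsilon> k \<omega>"
      using rew[OF k \<omega>] alg[OF k \<omega>] by simp
    have pq: "pr (?r \<omega>) k = p \<omega>" "qr (?r \<omega>) k = q \<omega>"
      using alg[OF k \<omega>] by (simp_all add: pr_def qr_def bvec_def p_def q_def b_def)
    show "ennreal (indicator (G (k div m)) \<omega> * Zr (?r \<omega>) (Suc k))
      = ennreal ((indicator (G (k div m)) \<omega> * Zr (?r \<omega>) k)
          * (exp ((2 * p \<omega> * (sqrt (wr (?r \<omega>) k) * \<epsilon> k \<omega>) + q \<omega> * (sqrt (wr (?r \<omega>) k) * \<epsilon> k \<omega>)\<^sup>2 - (p \<omega>)\<^sup>2)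
              / (2 * (1 + q \<omega>))) / sqrt (1 + q \<omega>)))"
      unfolding Zr_Suc e pq by (simp only: mult.assoc)
  qed
  also have "\<dots> \<le> (\<integral>\<^sup>+\<omega>. ennreal (indicator (G (k div m)) \<omega> * Zr (?r \<omega>) k) \<partial>M)"
    by (rule subgaussian_mixture_step[OF \<epsilon>_meas[OF k] v_meas Z_meas p_meas q_meas w_meas v0 sg])
       (auto intro!: q0 wv wr_nonneg Zr_nonneg mult_nonneg_nonneg)
  finally show ?thesis .
qed

text \<open>The indicator is the one in force in round \<open>k - 1\<close>, the last round entering
  \<open>Zr\<close> at \<open>k\<close>. Moving on may shrink the event, which only lowers the
  integral.\<close>

lemma supermartingale_le_1:
  assumes "k \<le> K"
  shows "(\<integral>\<^sup>+\<omega>. ennreal (indicator (G ((k - 1) div m)) \<omega> * Zr (rewards \<omega>) k) \<partial>M) \<le> 1"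
  using assms
proof (induction k)
  case 0
  have "(\<integral>\<^sup>+\<omega>. ennreal (indicator (G 0) \<omega> * Zr (rewards \<omega>) 0) \<partial>M) \<le> (\<integral>\<^sup>+\<omega>. 1 \<partial>M)"
    by (intro nn_integral_mono) (simp add: Zr_0 indicator_def)
  then show ?case
    by (simp add: emeasure_space_1)
next
  case (Suc k)
  have "(\<integral>\<^sup>+\<omega>. ennreal (indicator (G (k div m)) \<omega> * Zr (rewards \<omega>) (Suc k)) \<partial>M)
      \<le> (\<integral>\<^sup>+\<omega>. ennreal (indicator (G (k div m)) \<omega> * Zr (rewards \<omega>) k) \<partial>M)"
    using Suc by (intro supermartingale_step) simp
  also have "\<dots> \<le> (\<integral>\<^sup>+\<omega>. ennreal (indicator (G ((k - 1) div m)) \<omega> * Zr (rewards \<omega>) k) \<partial>M)"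
    using G_antimono[OF div_le_mono[OF diff_le_self[of k 1], of m]]
    by (intro nn_integral_mono ennreal_leI mult_right_mono Zr_nonneg) (auto simp: indicator_def)
  also have "\<dots> \<le> 1"
    using Suc by simp
  finally show ?case by simp
qed

lemma G_events: "m * t \<le> K \<Longrightarrow> G t \<in> events"
  by (rule G_measurable[where k = K]) (auto intro: A_meas R_meas)

lemma prob_first_failure:
  assumes "m * Suc t \<le> K"
  shows "prob (G t - G (Suc t)) \<le> del0"
proof -
  have ev: "G t \<in> events" "G (Suc t) \<in> events"
    using assms by (auto intro!: G_events)
  \<comment> \<open>The last round of the batch still carries the indicator of \<open>G t\<close>,
    not of \<open>G (Suc t)\<close>, so Markov's inequality sees the first failure.\<close>
  have idx: "(m * Suc t - 1) div m = t"
  proof -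
    have "m * Suc t - 1 = m * t + (m - 1)"
      using m_pos by simp
    then show ?thesis
      using m_pos by (simp only: div_mult_self4) simp
  qed
  have "ennreal (1 / del0) * emeasure M (G t - G (Suc t))
      = (\<integral>\<^sup>+\<omega>. ennreal (1 / del0) * indicator (G t - G (Suc t)) \<omega> \<partial>M)"
    using ev by (simp add: nn_integral_cmult_indicator)
  also have "\<dots> \<le> (\<integral>\<^sup>+\<omega>. ennreal (indicator (G t) \<omega> * Zr (rewards \<omega>) (m * Suc t)) \<partial>M)"
  proof (rule nn_integral_mono)
    fix \<omega>
    show "ennreal (1 / del0) * indicator (G t - G (Suc t)) \<omega>
        \<le> ennreal (indicator (G t) \<omega> * Zr (rewards \<omega>) (m * Suc t))"
    proof (cases "\<omega> \<in> G t - G (Suc t)")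
      case True
      then have "\<not> good (rewards \<omega>) (Suc t)"
        by (auto simp: G_def le_Suc_eq)
      from Zr_ge_if_not_good[OF this] True show ?thesis
        by (simp add: ennreal_leI)
    qed simp
  qed
  also have "\<dots> \<le> 1"
    using supermartingale_le_1[OF assms] unfolding idx .
  finally have "1 / del0 * prob (G t - G (Suc t)) \<le> 1"
    using del0 by (simp add: emeasure_eq_measure ennreal_mult[symmetric] ennreal_le_1)
  then show ?thesis
    using del0 by (simp add: field_simps)
qed

lemma prob_G_ge: "m * t \<le> K \<Longrightarrow> 1 - real t * del0 \<le> prob (G t)"
proof (induction t)
  case 0
  have "G 0 = space M"
    by (auto simp: G_def)
  then show ?case by (simp add: prob_space)
next
  case (Suc t)
  have le: "m * t \<le> K"
    using Suc.prems by simp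
  have "prob (G t - G (Suc t)) = prob (G t) - prob (G (Suc t))"
    using Suc.prems le by (intro finite_measure_Diff G_events G_antimono) auto
  then show ?case
    using Suc.IH[OF le] prob_first_failure[OF Suc.prems] by (simp add: algebra_simps)
qed

end

section \<open>Regret bound\<close>

theorem theorem3:
  fixes M :: "'a measure"
    and \<theta> th0 :: "real^'n"
    and E :: "real^'n^'n \<Rightarrow> nat \<Rightarrow> real^'n"
    and A :: "nat \<Rightarrow> 'a \<Rightarrow> real^'n"
    and R \<epsilon> \<sigma> :: "nat \<Rightarrow> 'a \<Rightarrow> real"
    and \<delta> lam0 :: real and Tb T :: nat
  defines "d \<equiv> CARD('n)"
  defines "T \<equiv> 2 * (d - 1) * Tb"
  assumes d2: "d \<ge> 2"
    and \<delta>: "0 < \<delta>" "\<delta> < 1"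
    and Tb: "Tb \<ge> 1"
    and lam0: "lam0 \<ge> max 2 (sqrt (2 / (3 * (real d - 1))) * (2 * real d) / (12 * sqrt (real d - 1))
                               + 2 / (3 * (real d - 1)))"
    and P: "prob_space M"
    and \<theta>: "norm \<theta> = 1"
    and th0: "norm th0 = 1"
    and E: "eig_selector E"
    and alg: "\<And>k \<omega>. k < T \<Longrightarrow> \<omega> \<in> space M \<Longrightarrow>
                A k \<omega> = linucb_action lam0 (\<delta> / real Tb) E th0 (\<lambda>j. R j \<omega>) k"
    and rew: "\<And>k \<omega>. k < T \<Longrightarrow> \<omega> \<in> space M \<Longrightarrow> R k \<omega> = \<theta> \<bullet> A k \<omega> + \<epsilon> k \<omega>"
    and A_meas: "\<And>k. k < T \<Longrightarrow> A k \<in> borel_measurable M"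
    and \<epsilon>_meas: "\<And>k. k < T \<Longrightarrow> \<epsilon> k \<in> borel_measurable M"
    and \<epsilon>_int: "\<And>k. k < T \<Longrightarrow> integrable M (\<epsilon> k)"
    and mean0: "\<And>k. k < T \<Longrightarrow>
                  AE \<omega> in M. real_cond_exp M (hist_alg M A R k) (\<epsilon> k) \<omega> = 0"
    and subg: "\<And>k \<mu>. k < T \<Longrightarrow>
                  AE \<omega> in M. nn_cond_exp M (hist_alg M A R k) (\<lambda>x. ennreal (exp (\<mu> * \<epsilon> k x))) \<omega>
                     \<le> ennreal (exp (\<mu>\<^sup>2 * (\<sigma> k \<omega>)\<^sup>2 / 2))"
    and \<sigma>_bd: "\<And>k \<omega>. k < T \<Longrightarrow> \<omega> \<in> space M \<Longrightarrow> (\<sigma> k \<omega>)\<^sup>2 \<le> 1 - (\<theta> \<bullet> A k \<omega>)\<^sup>2"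
  shows "prob_space.prob M {\<omega> \<in> space M.
           regret \<theta> (\<lambda>k. A k \<omega>) T
             \<le> 4 * (real d - 1)
               + (144 * (real d)\<^sup>2 * ((lam0 + sqrt (2 * ln (real T / \<delta>)
                     + real d * ln (1 / (144 * lam0) * (real T)\<^sup>2 + 1 / (6 * sqrt lam0) * real T + 1)))\<^sup>2)\<^sup>2
                  + 24 * (real d - 1) powr (3/2) * (lam0 + sqrt (2 * ln (real T / \<delta>)
                     + real d * ln (1 / (144 * lam0) * (real T)\<^sup>2 + 1 / (6 * sqrt lam0) * real T + 1)))\<^sup>2)
                 * ln (real T / (2 * (real d - 1)))}
         \<ge> 1 - \<delta>"
proof -
  have dT: "0 < \<delta> / real Tb" "\<delta> / real Tb \<le> 1" and lam2: "2 \<le> lam0"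
    using \<delta> Tb lam0 by (auto simp: divide_le_eq)
  interpret prob_space M
    by (rule P)
  interpret linucb_vn_bandit lam0 "\<delta> / real Tb" E th0 \<theta> M A R \<epsilon> \<sigma> T
    by unfold_locales (use E lam2 dT th0 \<theta> d2 alg rew A_meas \<epsilon>_meas subg \<sigma>_bd in \<open>auto simp: d_def\<close>)
  have mT: "T = m * Tb"
    by (simp add: T_def m_def d_def)
  have D: "real d - 1 = D" "real d = D + 1"
    by (simp_all add: D_def d_def)
  \<comment> \<open>The last batch is played from the state after \<open>Tb - 1\<close> batches, so
    the event \<open>G n\<close> suffices.\<close>
  obtain n where n: "Tb = Suc n"
    using Tb by (cases Tb) auto
  define \<beta> where "\<beta> = (lam0 + sqrt (2 * ln (real T / \<delta>)
      + real d * ln (1 / (144 * lam0) * (real T)\<^sup>2 + 1 / (6 * sqrt lam0) * real T + 1)))\<^sup>2"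
  define bound where "bound = 4 * (real d - 1) + (144 * (real d)\<^sup>2 * \<beta>\<^sup>2
      + 24 * (real d - 1) powr (3/2) * \<beta>) * ln (real T / (2 * (real d - 1)))"
  have \<beta>: "\<beta> = B Tb \<delta>"
    unfolding \<beta>_def B_def[OF Tb \<delta>(1) refl] mT d_def ..
  have "real T / (2 * (real d - 1)) = real Tb"
    using D_ge1 by (simp add: mT real_m D)
  \<comment> \<open>The \<open>powr\<close> term of the coefficient is nonnegative and is
    dropped.\<close>
  then have bound: "4 * D + 144 * (D + 1)\<^sup>2 * (B Tb \<delta>)\<^sup>2 * ln (real Tb) \<le> bound"
    using Tb B_ge2[OF Tb \<delta>(1) refl] unfolding bound_def D \<beta>[symmetric]
    by (simp add: distrib_right \<beta>_def)
  let ?S = "{\<omega> \<in> space M. regret \<theta> (\<lambda>k. A k \<omega>) T \<le> bound}"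
  have "G n \<subseteq> ?S"
  proof
    fix \<omega> assume \<omega>: "\<omega> \<in> G n"
    then have sp: "\<omega> \<in> space M"
      by (simp add: G_def)
    have "regret \<theta> (\<lambda>k. A k \<omega>) T = regret \<theta> (act (rewards \<omega>)) (m * Suc n)"
      unfolding regret_def mT n by (intro sum.cong) (use alg sp mT n in auto)
    also have "\<dots> \<le> 4 * D + 144 * (D + 1)\<^sup>2 * (B Tb \<delta>)\<^sup>2 * ln (real (Suc n))"
    proof (rule regret_bound[OF Tb \<delta>(1) refl])
      show "good (rewards \<omega>) t" if "0 < t" "t < Tb" for t
      proof -
        have "t \<le> n"
          using that(2) n by simp
        then show ?thesis
          using \<omega> that(1) by (simp add: G_def)
      qed
    qed (simp add: n)
    finally show "\<omega> \<in> ?S"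
      using bound sp n by auto
  qed
  moreover have "?S \<in> events"
    unfolding regret_def
    by (intro borel_measurable_le borel_measurable_sum borel_measurable_diff borel_measurable_inner
        borel_measurable_const A_meas) auto
  ultimately have "prob (G n) \<le> prob ?S"
    by (rule finite_measure_mono)
  moreover have "1 - real n * (\<delta> / real Tb) \<le> prob (G n)"
    by (rule prob_G_ge) (simp add: mT n)
  moreover have "real n * (\<delta> / real Tb) \<le> \<delta>"
    using \<delta> by (simp add: n field_simps)
  ultimately show ?thesis
    unfolding bound_def \<beta>_def by linarith
qed

end
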